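(* For each integer $r \geq 2$, there exists a constant $C = C(r) > 0$ such that the following holds. Let $n, k$ be positive integers with $n \geq 2k + C k^{2/3}$, and let $\mathcal{F} \subset \binom{[n]}{k}$ be a union of at most $r$ intersecting families (i.e.\ $\mathcal{F} = \mathcal{F}_1 \cup \cdots \cup \mathcal{F}_m$ with $m \leq r$, where each $\mathcal{F}_i \subset \binom{[n]}{k}$ is intersecting). Then $$|\mathcal{F}| \leq \binom{n}{k} - \binom{n-r}{k},$$ and equality holds only if $\mathcal{F} = \{S \in \binom{[n]}{k} : S \cap R \neq \emptyset\}$ for some $R \in \binom{[n]}{r}$.
   Context: $[n] = \{1,\ldots,n\}$ and $\binom{[n]}{k}$ is the set of $k$-element subsets of $[n]$. A family of sets is intersecting if any two of its members have nonempty intersection. *)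

theory Defs
  imports Complex_Main "HOL-Library.Ramsey"
begin

definition intersecting :: "'a set set \<Rightarrow> bool" where
  "intersecting F \<longleftrightarrow> (\<forall>A\<in>F. \<forall>B\<in>F. A \<inter> B \<noteq> {})"

definition union_of_intersecting :: "nat \<Rightarrow> nat \<Rightarrow> nat \<Rightarrow> nat set set \<Rightarrow> bool" where
  "union_of_intersecting r n k F \<longleftrightarrow>
     (\<exists>m G. m \<le> r \<and>
        (\<forall>i\<in>{1..m}. G i \<subseteq> [{1..n}]\<^bsup>k\<^esup> \<and> intersecting (G i)) \<and>
        F = (\<Union>i\<in>{1..m::nat}. G i))"

end

theory Submission
  imports Defs "HOL-Analysis.Analysis"
begin

text \<open>
  Suppose \<open>|F|\<close> is at least the claimed maximum. The sets containing no member of \<open>F\<close> form a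
  down-closed family \<open>D\<close> with at most \<open>(n - r choose k)\<close> sets of size \<open>k\<close>, so by
  Kruskal-Katona its \<open>p\<close>-biased measure is at most \<open>(1 - p)^r\<close> plus a binomial tail, for
  \<open>p\<close> halfway between \<open>k/n\<close> and \<open>1/2\<close>. On the other hand \<open>D\<close> is the intersection of the
  complements of the up-closures of the \<open>F_i\<close>, each of measure at least \<open>1 - p\<close>, so Harris'
  inequality forces every up-closure to have measure \<open>p\<close> up to an exponentially small error.

  For an increasing intersecting family, with \<open>p = 2^(-c)\<close>, the inequality
  \<open>\<mu>_p(A) \<le> \<mu>_(1/2)(A)^c\<close> applied to the two sections in a direction \<open>x\<close> shows that the
  lower section has \<open>1/2\<close>-measure near \<open>0\<close> or near \<open>1/2\<close>. By Poincare's inequality it cannot be near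
  \<open>1/2\<close> in all directions, so each \<open>F_i\<close> is, up to few exceptional sets, a star with some centre \<open>x_i\<close>.

  Finally, the exceptional sets of \<open>F_i\<close> exclude all sets of the star of \<open>x_i\<close> that are disjoint
  from one of them. Since there are so few exceptional sets, Kruskal-Katona makes the number of sets lost
  exceed their number by a factor larger than \<open>2r\<close>, so there are none.
  This is where \<open>n - 2k\<close> of order \<open>k^(2/3)\<close> is needed: gaining a constant factor takes about
  \<open>k/(n - 2k)\<close> halvings, which the error \<open>exp(-(n - 2k)^2/16n)\<close> affords.
\<close>

section \<open>Shadows\<close>

definition down_closed :: "'a set set \<Rightarrow> bool" where
  "down_closed D \<longleftrightarrow> (\<forall>S T. T \<in> D \<longrightarrow> S \<subseteq> T \<longrightarrow> S \<in> D)"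

definition up_closed :: "'a set set \<Rightarrow> bool" where
  "up_closed A \<longleftrightarrow> (\<forall>S T. S \<in> A \<longrightarrow> S \<subseteq> T \<longrightarrow> T \<in> A)"

lemma down_closedD: "down_closed D \<Longrightarrow> T \<in> D \<Longrightarrow> S \<subseteq> T \<Longrightarrow> S \<in> D"
  unfolding down_closed_def by blast

lemma up_closedD: "up_closed A \<Longrightarrow> S \<in> A \<Longrightarrow> S \<subseteq> T \<Longrightarrow> T \<in> A"
  unfolding up_closed_def by blast

lemma sum_degrees:
  assumes "finite V" "A \<subseteq> [V]\<^bsup>k\<^esup>"
  shows "(\<Sum>v\<in>V. card {S\<in>A. v \<in> S}) = k * card A"
proof -
  have fin: "finite A"
    using assms by (meson finite_imp_finite_nsets finite_subset)
  have "(\<Sum>v\<in>V. card {S\<in>A. v \<in> S}) = (\<Sum>v\<in>V. \<Sum>S\<in>A. if v \<in> S then 1 else 0)"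
    using fin by (intro sum.cong refl) (simp add: sum.If_cases Int_def)
  also have "\<dots> = (\<Sum>S\<in>A. \<Sum>v\<in>V. if v \<in> S then 1 else 0)"
    by (rule sum.swap)
  also have "\<dots> = (\<Sum>S\<in>A. k)"
  proof (intro sum.cong refl)
    fix S assume "S \<in> A"
    then have "S \<subseteq> V" "card S = k" using assms(2) by (auto simp: nsets_def)
    moreover from this have "V \<inter> {v. v \<in> S} = S" by auto
    ultimately show "(\<Sum>v\<in>V. if v \<in> S then 1 else 0) = k"
      using assms(1) by (simp add: sum.If_cases)
  qed
  finally show ?thesis by simp
qed

lemma choose_Suc_mult: "Suc j * (N choose Suc j) = (N - j) * (N choose j)"
  by (metis binomial_absorption binomial_absorb_comp)

text \<open>
  Kruskal-Katona in Lovasz' form, at integer parameters, following Keevash: the cliques through a vertex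
  \<open>v\<close> are bounded by induction in the link of \<open>v\<close> if \<open>v\<close> has small degree, and by the number of edges
  avoiding \<open>v\<close> otherwise.
\<close>
lemma card_clique_le:
  assumes "k \<ge> 1" "finite V" "A \<subseteq> [V]\<^bsup>k\<^esup>" "B \<subseteq> [V]\<^bsup>Suc k\<^esup>"
    and "\<And>T x. T \<in> B \<Longrightarrow> x \<in> T \<Longrightarrow> T - {x} \<in> A"
    and "card A \<le> N choose k"
  shows "Suc k * card B \<le> (N - k) * card A"
  using assms
proof (induction k arbitrary: N A B rule: nat_induct_at_least)
  case base
  define U where "U = \<Union>A"
  have finA: "finite A"
    using base by (meson finite_imp_finite_nsets finite_subset)
  have sing: "\<exists>x. S = {x}" if "S \<in> A" for S
    using that base(2) by (auto simp: nsets_def card_Suc_eq)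
  have A: "A = (\<lambda>x. {x}) ` U"
    using sing unfolding U_def by fastforce
  have cA: "card A = card U"
    unfolding A by (rule card_image) auto
  have finU: "finite U"
    using finA unfolding A by (auto dest: finite_imageD)
  have "B \<subseteq> [U]\<^bsup>2\<^esup>"
  proof
    fix T assume T: "T \<in> B"
    then have c: "card T = 2" "finite T" using base(3) by (auto simp: nsets_def)
    have "T \<subseteq> U"
    proof
      fix x assume x: "x \<in> T"
      with c obtain y where "y \<in> T" "y \<noteq> x"
        by (metis card_2_iff')
      then show "x \<in> U" using base(4)[OF T, of y] x unfolding U_def by blast
    qed
    with c show "T \<in> [U]\<^bsup>2\<^esup>" by (auto simp: nsets_def)
  qed
  then have "card B \<le> card U choose 2"
    by (metis card_mono card_nsets finU finite_imp_finite_nsets)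
  then have "2 * card B \<le> card U * (card U - 1)"
    by (simp add: choose_two)
  also have "\<dots> \<le> card U * (N - 1)"
    using base(5) cA by (intro mult_le_mono) auto
  finally show ?case by (simp add: cA mult.commute numeral_2_eq_2)
next
  case (Suc k)
  note k = \<open>1 \<le> k\<close> and finV = \<open>finite V\<close>
  note AV = \<open>A \<subseteq> [V]\<^bsup>Suc k\<^esup>\<close> and BV = \<open>B \<subseteq> [V]\<^bsup>Suc (Suc k)\<^esup>\<close>
  note clq = \<open>\<And>T x. T \<in> B \<Longrightarrow> x \<in> T \<Longrightarrow> T - {x} \<in> A\<close>
  note cA = \<open>card A \<le> N choose Suc k\<close>
  have finA: "finite A"
    using AV finV by (meson finite_imp_finite_nsets finite_subset)
  show ?case
  proof (cases "N \<ge> Suc k")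
    case False
    then have "A = {}" using cA finA by (simp add: binomial_eq_0)
    moreover have "T \<noteq> {}" if "T \<in> B" for T using that BV by (auto simp: nsets_def)
    ultimately have "B = {}" using clq by fastforce
    then show ?thesis by simp
  next
    case True
    then obtain M where N: "N = Suc M" "M \<ge> k" by (cases N) auto
    have loc: "Suc k * card {T\<in>B. v \<in> T} \<le> (M - k) * card {S\<in>A. v \<in> S}" if "v \<in> V" for v
    proof -
      define Av where "Av = (\<lambda>S. S - {v}) ` {S\<in>A. v \<in> S}"
      define Bv where "Bv = (\<lambda>S. S - {v}) ` {S\<in>B. v \<in> S}"
      have inj: "inj_on (\<lambda>S. S - {v}) {S\<in>Q. v \<in> S}" for Q
        by (rule inj_onI) (metis (no_types, lifting) insert_Diff mem_Collect_eq)
      have cAv: "card Av = card {S\<in>A. v \<in> S}" and cBv: "card Bv = card {S\<in>B. v \<in> S}"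
        unfolding Av_def Bv_def by (auto intro!: card_image inj)
      show ?thesis
      proof (cases "card Av \<le> M choose k")
        case True
        have "Suc k * card Bv \<le> (M - k) * card Av"
        proof (rule Suc.IH[OF finV _ _ _ True])
          show "Av \<subseteq> [V]\<^bsup>k\<^esup>" using AV by (auto simp: Av_def nsets_def)
          show "Bv \<subseteq> [V]\<^bsup>Suc k\<^esup>" using BV by (auto simp: Bv_def nsets_def)
        next
          fix T x assume "T \<in> Bv" "x \<in> T"
          then obtain S where S: "S \<in> B" "v \<in> S" "T = S - {v}" "x \<in> S" "x \<noteq> v"
            by (auto simp: Bv_def)
          then have "S - {x} \<in> A" "v \<in> S - {x}" "T - {x} = (S - {x}) - {v}" using clq by auto
          then show "T - {x} \<in> Av" unfolding Av_def by blast
        qed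
        then show ?thesis by (simp add: cAv cBv)
      next
        case False
        have "Bv \<subseteq> {S\<in>A. v \<notin> S}" using clq by (auto simp: Bv_def)
        then have "card Bv \<le> card {S\<in>A. v \<notin> S}" using finA by (simp add: card_mono)
        moreover have "card A = card {S\<in>A. v \<in> S} + card {S\<in>A. v \<notin> S}"
          using finA by (subst card_Un_disjoint[symmetric]) (auto intro!: arg_cong[where f=card])
        ultimately have "card Bv \<le> M choose Suc k"
          using cA False cAv by (simp add: N)
        then have "Suc k * card Bv \<le> Suc k * (M choose Suc k)" by (rule mult_le_mono2)
        also have "\<dots> = (M - k) * (M choose k)"
          by (rule choose_Suc_mult)
        also have "\<dots> \<le> (M - k) * card Av" using False by simp
        finally show ?thesis by (simp add: cAv cBv)
      qed
    qed
    \<comment> \<open>Each member of \<open>B\<close> has \<open>k + 2\<close> points and each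
      member of \<open>A\<close> has \<open>k + 1\<close>, so summing the link bounds over
      \<open>v\<close> recovers both cardinalities with these weights.\<close>
    have "Suc k * (\<Sum>v\<in>V. card {T\<in>B. v \<in> T}) \<le> (M - k) * (\<Sum>v\<in>V. card {S\<in>A. v \<in> S})"
      unfolding sum_distrib_left by (rule sum_mono) (rule loc)
    then have "Suc k * (Suc (Suc k) * card B) \<le> Suc k * ((M - k) * card A)"
      unfolding sum_degrees[OF finV AV] sum_degrees[OF finV BV] by (simp only: mult.left_commute)
    then show ?thesis unfolding N by (metis Suc_mult_le_cancel1 diff_Suc_Suc)
  qed
qed

text \<open>Level \<open>j + 1\<close> of a down-closed family consists of cliques over level
  \<open>j\<close>, so \<open>card_clique_le\<close> can be iterated upwards. The bound by
  \<open>N choose j\<close> is carried along because each application requires it.\<close>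

lemma level_ratio:
  assumes D: "down_closed D" and X: "finite X" and k: "1 \<le> k" "k \<le> j"
    and le: "card (D \<inter> [X]\<^bsup>k\<^esup>) \<le> N choose k"
  shows "card (D \<inter> [X]\<^bsup>j\<^esup>) \<le> N choose j"
    and "card (D \<inter> [X]\<^bsup>j\<^esup>) * (N choose k) \<le> card (D \<inter> [X]\<^bsup>k\<^esup>) * (N choose j)"
proof -
  let ?a = "\<lambda>j. card (D \<inter> [X]\<^bsup>j\<^esup>)"
  have "?a j \<le> N choose j \<and> ?a j * (N choose k) \<le> ?a k * (N choose j)"
    using k(2)
  proof (induction j rule: dec_induct)
    case base
    then show ?case using le by simp
  next
    case (step j)
    have st: "Suc j * ?a (Suc j) \<le> (N - j) * ?a j"
    proof (rule card_clique_le[OF _ X])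
      show "1 \<le> j" using k step by simp
      show "?a j \<le> N choose j" using step by simp
      fix T x assume "T \<in> D \<inter> [X]\<^bsup>Suc j\<^esup>" "x \<in> T"
      then show "T - {x} \<in> D \<inter> [X]\<^bsup>j\<^esup>"
        using down_closedD[OF D, of T "T - {x}"] by (auto simp: nsets_def)
    qed auto
    have "Suc j * ?a (Suc j) \<le> (N - j) * (N choose j)"
      using st step.IH by (meson le_trans mult_le_mono2)
    then have 1: "?a (Suc j) \<le> N choose Suc j"
      using choose_Suc_mult[of j N] by (metis Suc_mult_le_cancel1)
    have "Suc j * (?a (Suc j) * (N choose k)) \<le> (N - j) * (?a j * (N choose k))"
      using mult_le_mono1[OF st, of "N choose k"] by (simp only: mult.assoc)
    also have "\<dots> \<le> (N - j) * (?a k * (N choose j))" using step.IH by simp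
    also have "\<dots> = Suc j * (?a k * (N choose Suc j))"
      using choose_Suc_mult[of j N] by (metis mult.left_commute)
    finally have "?a (Suc j) * (N choose k) \<le> ?a k * (N choose Suc j)"
      by (metis Suc_mult_le_cancel1)
    with 1 show ?case by blast
  qed
  then show "?a j \<le> N choose j" "?a j * (N choose k) \<le> ?a k * (N choose j)" by auto
qed

text \<open>Applied to the down-closure of the family, \<open>level_ratio\<close> bounds level
  \<open>a\<close> above in terms of level \<open>b\<close>; read backwards this is a lower bound on
  the shadow. If the shadow already exceeds \<open>N choose b\<close>, the size hypothesis on
  \<open>\<A>\<close> suffices.\<close>

lemma card_shadow_ge:
  assumes Y: "finite Y" and A: "\<A> \<subseteq> [Y]\<^bsup>a\<^esup>" and b: "1 \<le> b" "b \<le> a"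
    and le: "card \<A> \<le> N choose a"
  shows "card \<A> * (N choose b) \<le> card {T. card T = b \<and> (\<exists>A\<in>\<A>. T \<subseteq> A)} * (N choose a)"
proof -
  define D where "D = {T. \<exists>A\<in>\<A>. T \<subseteq> A}"
  have D: "down_closed D" unfolding D_def down_closed_def by blast
  have E: "{T. card T = b \<and> (\<exists>A\<in>\<A>. T \<subseteq> A)} = D \<inter> [Y]\<^bsup>b\<^esup>"
    using A Y by (auto simp: D_def nsets_def intro: finite_subset)
  have "\<A> \<subseteq> D \<inter> [Y]\<^bsup>a\<^esup>" using A by (auto simp: D_def)
  then have cA: "card \<A> \<le> card (D \<inter> [Y]\<^bsup>a\<^esup>)"
    using Y by (intro card_mono) (auto simp: finite_imp_finite_nsets)
  show ?thesis
  proof (cases "card (D \<inter> [Y]\<^bsup>b\<^esup>) \<le> N choose b")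
    case True
    show ?thesis
      using level_ratio(2)[OF D Y b True] cA unfolding E by (meson le_trans mult_le_mono1)
  next
    case False
    then have "(N choose b) * card \<A> \<le> card (D \<inter> [Y]\<^bsup>b\<^esup>) * (N choose a)"
      using le by (intro mult_le_mono) auto
    then show ?thesis unfolding E by (simp add: mult.commute)
  qed
qed

section \<open>Biased measures\<close>

text \<open>The probability that a random subset of \<open>X\<close>, containing each point
  independently with probability \<open>p\<close>, lies in \<open>A\<close>. As \<open>A\<close>
  need not consist of subsets of \<open>X\<close>, its lower section in direction \<open>x\<close>
  is \<open>A\<close> itself measured on \<open>X - {x}\<close>; the upper section is
  \<open>{S. insert x S \<in> A}\<close>.\<close>

definition bmeas :: "real \<Rightarrow> 'a set \<Rightarrow> 'a set set \<Rightarrow> real" where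
  "bmeas p X A = (\<Sum>S\<in>Pow X \<inter> A. p ^ card S * (1 - p) ^ (card X - card S))"

lemma bmeas_empty_ground: "bmeas p {} A = (if {} \<in> A then 1 else 0)"
  by (simp add: bmeas_def Int_insert_left)

lemma bmeas_insert:
  assumes "finite X" "x \<notin> X"
  shows "bmeas p (insert x X) A = p * bmeas p X {S. insert x S \<in> A} + (1 - p) * bmeas p X A"
proof -
  let ?w = "\<lambda>S. p ^ card S * (1 - p) ^ (card (insert x X) - card S)"
  have split: "Pow (insert x X) \<inter> A = (Pow X \<inter> A) \<union> insert x ` (Pow X \<inter> {S. insert x S \<in> A})"
    unfolding Pow_insert by blast
  have le: "card S \<le> card X" if "S \<in> Pow X" for S
    using that assms by (auto intro: card_mono)
  have "bmeas p (insert x X) A = sum ?w (Pow X \<inter> A) + sum ?w (insert x ` (Pow X \<inter> {S. insert x S \<in> A}))"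
    unfolding bmeas_def split using assms by (intro sum.union_disjoint) auto
  also have "sum ?w (insert x ` (Pow X \<inter> {S. insert x S \<in> A}))
      = (\<Sum>S\<in>Pow X \<inter> {S. insert x S \<in> A}. ?w (insert x S))"
    using assms(2) by (intro sum.reindex_cong[of "insert x"]) (auto simp: inj_on_def)
  also have "\<dots> = p * bmeas p X {S. insert x S \<in> A}"
    unfolding bmeas_def sum_distrib_left
  proof (intro sum.cong refl)
    fix S assume "S \<in> Pow X \<inter> {S. insert x S \<in> A}"
    then have "x \<notin> S" "finite S" using assms by (auto intro: finite_subset)
    then show "?w (insert x S) = p * (p ^ card S * (1 - p) ^ (card X - card S))"
      using assms by simp
  qed
  also have "sum ?w (Pow X \<inter> A) = (1 - p) * bmeas p X A"
    unfolding bmeas_def sum_distrib_left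
    using assms le by (intro sum.cong refl) (simp add: Suc_diff_le)
  finally show ?thesis by simp
qed

lemma bmeas_split:
  assumes "finite X" "x \<in> X"
  shows "bmeas p X A = p * bmeas p (X - {x}) {S. insert x S \<in> A} + (1 - p) * bmeas p (X - {x}) A"
  using bmeas_insert[of "X - {x}" x p A] assms by (simp add: insert_absorb)

lemma bmeas_nonneg: "0 \<le> p \<Longrightarrow> p \<le> 1 \<Longrightarrow> 0 \<le> bmeas p X A"
  unfolding bmeas_def by (intro sum_nonneg) auto

lemma bmeas_mono:
  assumes "0 \<le> p" "p \<le> 1" "finite X" "Pow X \<inter> A \<subseteq> B"
  shows "bmeas p X A \<le> bmeas p X B"
  unfolding bmeas_def using assms by (intro sum_mono2) auto

lemma bmeas_Un_le:
  assumes "0 \<le> p" "p \<le> 1" "finite X"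
  shows "bmeas p X (A \<union> B) \<le> bmeas p X A + bmeas p X B"
proof -
  have "bmeas p X (A \<union> B) + bmeas p X (A \<inter> B) = bmeas p X A + bmeas p X B"
    unfolding bmeas_def Int_Un_distrib
    using assms(3) sum.union_inter[of "Pow X \<inter> A" "Pow X \<inter> B"] by (simp add: Int_ac)
  with bmeas_nonneg[OF assms(1,2)] show ?thesis by (smt (verit))
qed

lemma bmeas_UNIV: "finite X \<Longrightarrow> bmeas p X UNIV = 1"
  by (induction X rule: finite_induct) (simp_all add: bmeas_empty_ground bmeas_insert)

lemma bmeas_Compl: "finite X \<Longrightarrow> bmeas p X (- A) = 1 - bmeas p X A"
proof -
  assume X: "finite X"
  have "bmeas p X A + bmeas p X (- A) = bmeas p X UNIV"
    unfolding bmeas_def using X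
    by (subst sum.union_disjoint[symmetric]) (auto intro!: sum.cong)
  then show ?thesis using bmeas_UNIV[OF X, of p] by simp
qed

lemma bmeas_le_1: "0 \<le> p \<Longrightarrow> p \<le> 1 \<Longrightarrow> finite X \<Longrightarrow> bmeas p X A \<le> 1"
  using bmeas_mono[of p X A UNIV] bmeas_UNIV[of X p] by simp

section \<open>Sections of monotone families and inequalities for their measures\<close>

lemma up_closed_link: "up_closed A \<Longrightarrow> up_closed {S. insert x S \<in> A}"
  unfolding up_closed_def by (metis insert_mono mem_Collect_eq)

lemma down_closed_link: "down_closed A \<Longrightarrow> down_closed {S. insert x S \<in> A}"
  unfolding down_closed_def by (metis insert_mono mem_Collect_eq)

lemma down_closed_Compl: "up_closed A \<Longrightarrow> down_closed (- A)"
  unfolding up_closed_def down_closed_def by blast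

lemma bmeas_link_ge:
  assumes "0 \<le> p" "p \<le> 1" "finite X" "up_closed A"
  shows "bmeas p X A \<le> bmeas p X {S. insert x S \<in> A}"
  using assms(4) by (intro bmeas_mono assms) (auto intro: up_closedD)

lemma bmeas_link_le:
  assumes "0 \<le> p" "p \<le> 1" "finite X" "down_closed A"
  shows "bmeas p X {S. insert x S \<in> A} \<le> bmeas p X A"
  using assms(4) by (intro bmeas_mono assms) (auto intro: down_closedD)

text \<open>Induction on the ground set, conditioning on one point. Upper sections of down-closed
  families have at most the measure of the lower ones, so the covariance term
  \<open>p * (1 - p) * ((a0 - a1) * (b0 - b1))\<close> is nonnegative.\<close>

lemma harris_inequality:
  assumes "0 \<le> p" "p \<le> 1" "finite X" "down_closed A" "down_closed B"
  shows "bmeas p X A * bmeas p X B \<le> bmeas p X (A \<inter> B)"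
  using assms(3-5)
proof (induction X arbitrary: A B rule: finite_induct)
  case empty
  then show ?case by (simp add: bmeas_empty_ground)
next
  case (insert x X)
  let ?l = "\<lambda>A. {S. insert x S \<in> A}"
  define a1 a0 b1 b0 where "a1 = bmeas p X (?l A)" and "a0 = bmeas p X A"
    and "b1 = bmeas p X (?l B)" and "b0 = bmeas p X B"
  have le: "a1 \<le> a0" "b1 \<le> b0"
    unfolding a1_def a0_def b1_def b0_def using insert assms by (auto intro!: bmeas_link_le)
  have "(p * a1 + (1 - p) * a0) * (p * b1 + (1 - p) * b0)
      = p * (a1 * b1) + (1 - p) * (a0 * b0) - p * (1 - p) * ((a0 - a1) * (b0 - b1))"
    by algebra
  also have "\<dots> \<le> p * (a1 * b1) + (1 - p) * (a0 * b0)"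
    using le assms by simp
  also have "\<dots> \<le> p * bmeas p X (?l (A \<inter> B)) + (1 - p) * bmeas p X (A \<inter> B)"
  proof -
    have "?l (A \<inter> B) = ?l A \<inter> ?l B" by auto
    then show ?thesis
      using insert.IH[of "?l A" "?l B"] insert.IH[of A B] insert.prems assms
      unfolding a1_def a0_def b1_def b0_def
      by (intro add_mono mult_left_mono) (auto intro: down_closed_link)
  qed
  finally show ?case
    using insert by (simp add: bmeas_insert a1_def a0_def b1_def b0_def)
qed

lemma harris_inequality_INT:
  assumes "0 \<le> p" "p \<le> 1" "finite X" "finite I" "\<And>i. i \<in> I \<Longrightarrow> down_closed (D i)"
  shows "(\<Prod>i\<in>I. bmeas p X (D i)) \<le> bmeas p X (\<Inter>i\<in>I. D i)"
  using assms(4,5)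
proof (induction I rule: finite_induct)
  case empty
  then show ?case using assms by (simp add: bmeas_UNIV)
next
  case (insert i I)
  have dc: "down_closed (\<Inter>i\<in>I. D i)"
    using insert.prems unfolding down_closed_def by blast
  have "(\<Prod>i\<in>insert i I. bmeas p X (D i)) \<le> bmeas p X (D i) * bmeas p X (\<Inter>i\<in>I. D i)"
    using insert assms by (auto intro!: mult_left_mono bmeas_nonneg)
  also have "\<dots> \<le> bmeas p X (D i \<inter> (\<Inter>i\<in>I. D i))"
    using insert dc assms by (intro harris_inequality) auto
  finally show ?case by simp
qed

text \<open>The one-point case behind \<open>bmeas_le_half_powr\<close>. By homogeneity it reduces
  to \<open>w powr c + (2 powr c - 1) \<le> (w + 1) powr c\<close> for
  \<open>w = u / v \<ge> 1\<close>: equality holds at \<open>w = 1\<close>, and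
  \<open>(w + 1) powr c - w powr c\<close> is nondecreasing.\<close>

lemma two_point_powr:
  fixes c u v :: real
  assumes c: "c \<ge> 1" and uv: "0 \<le> v" "v \<le> u"
  shows "2 powr (-c) * u powr c + (1 - 2 powr (-c)) * v powr c \<le> ((u + v) / 2) powr c"
proof (cases "v = 0")
  case True
  then show ?thesis using uv by (simp add: powr_divide powr_minus field_simps)
next
  case False
  with uv have pos: "v > 0" "u > 0" by auto
  define w where "w = u / v"
  have w: "w \<ge> 1" using pos uv by (simp add: w_def)
  have "(1 + 1) powr c - 1 powr c \<le> (w + 1) powr c - w powr c"
  proof (rule DERIV_nonneg_imp_nondecreasing[OF w])
    fix x :: real assume x: "1 \<le> x" "x \<le> w"
    have "((\<lambda>x. (x + 1) powr c - x powr c) has_real_derivative (c * (x + 1) powr (c - 1) - c * x powr (c - 1))) (at x)"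
      using x by (auto intro!: derivative_eq_intros)
    moreover have "0 \<le> c * (x + 1) powr (c - 1) - c * x powr (c - 1)"
      using x c by (auto intro!: mult_left_mono powr_mono2)
    ultimately show "\<exists>y. ((\<lambda>x. (x + 1) powr c - x powr c) has_real_derivative y) (at x) \<and> 0 \<le> y"
      by blast
  qed
  then have "w powr c + (2 powr c - 1) \<le> (w + 1) powr c" by simp
  then have "(w powr c + (2 powr c - 1)) * v powr c \<le> (w + 1) powr c * v powr c"
    by (rule mult_right_mono) simp
  also have "(w + 1) powr c * v powr c = (u + v) powr c"
  proof -
    have "(w + 1) * v = u + v" using pos by (simp add: w_def field_simps)
    then show ?thesis using pos w by (metis powr_mult)
  qed
  also have "(w powr c + (2 powr c - 1)) * v powr c = u powr c + (2 powr c - 1) * v powr c"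
    using pos by (simp add: w_def powr_divide field_simps)
  finally have "2 powr (-c) * (u powr c + (2 powr c - 1) * v powr c) \<le> 2 powr (-c) * (u + v) powr c"
    by (rule mult_left_mono) simp
  then show ?thesis
    using pos by (simp add: powr_divide powr_minus field_simps)
qed

text \<open>The two-point inequality tensorises: induction bounds both sections and
  \<open>two_point_powr\<close> recombines them. The family of all supersets of a fixed subset of
  \<open>X\<close> attains equality, so nothing is lost on stars.\<close>

lemma bmeas_le_half_powr:
  fixes c :: real
  assumes c: "c \<ge> 1" and X: "finite X" and A: "up_closed A"
  shows "bmeas (2 powr (-c)) X A \<le> bmeas (1/2) X A powr c"
  using X A
proof (induction X arbitrary: A rule: finite_induct)
  case empty
  then show ?case by (simp add: bmeas_empty_ground)
next
  case (insert x X)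
  let ?p = "2 powr (-c) :: real"
  have p: "0 \<le> ?p" "?p \<le> 1" using c by (auto simp: powr_le_one_le powr_minus field_simps ge_one_powr_ge_zero)
  define u v where "u = bmeas (1/2) X {S. insert x S \<in> A}" and "v = bmeas (1/2) X A"
  have uv: "0 \<le> v" "v \<le> u"
    unfolding u_def v_def using insert by (auto intro!: bmeas_nonneg bmeas_link_ge)
  have "bmeas ?p (insert x X) A \<le> ?p * u powr c + (1 - ?p) * v powr c"
    unfolding bmeas_insert[OF insert(1,2)] u_def v_def using insert p
    by (intro add_mono mult_left_mono insert.IH) (auto intro: up_closed_link)
  also have "\<dots> \<le> ((u + v) / 2) powr c" by (rule two_point_powr[OF c uv])
  also have "(u + v) / 2 = bmeas (1/2) (insert x X) A"
    by (simp add: bmeas_insert[OF insert(1,2)] u_def v_def field_simps)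
  finally show ?case .
qed

text \<open>The left side is four times the variance of the indicator of \<open>A\<close>, the right
  side its total influence. Splitting along \<open>x\<close>, the left side is the average over the
  two sections plus \<open>(u - v)\<^sup>2\<close>, which is at most the influence
  \<open>u - v\<close> of \<open>x\<close>.\<close>

lemma poincare_inequality:
  assumes "finite X" "up_closed A"
  shows "4 * bmeas (1/2) X A * (1 - bmeas (1/2) X A)
     \<le> (\<Sum>x\<in>X. bmeas (1/2) (X - {x}) {S. insert x S \<in> A} - bmeas (1/2) (X - {x}) A)"
  using assms
proof (induction X arbitrary: A rule: finite_induct)
  case empty
  then show ?case by (simp add: bmeas_empty_ground)
next
  case (insert x X)
  let ?l = "\<lambda>x A. {S. insert x S \<in> A}"
  let ?I = "\<lambda>X x A. bmeas (1/2) (X - {x}) (?l x A) - bmeas (1/2) (X - {x}) A"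
  define u v where "u = bmeas (1/2) X (?l x A)" and "v = bmeas (1/2) X A"
  have uv: "0 \<le> v" "v \<le> u" "u \<le> 1"
    unfolding u_def v_def using insert.hyps insert.prems by (auto intro!: bmeas_nonneg bmeas_link_ge bmeas_le_1)
  have I: "?I (insert x X) y A = (?I X y (?l x A) + ?I X y A) / 2" if y: "y \<in> X" for y
  proof -
    have e: "insert x X - {y} = insert x (X - {y})" using y insert.hyps by auto
    have n: "finite (X - {y})" "x \<notin> X - {y}" using insert.hyps by auto
    have "?l y (?l x A) = ?l x (?l y A)" by (auto simp: insert_commute)
    then show ?thesis unfolding e bmeas_insert[OF n] by (simp add: field_simps)
  qed
  define \<Sigma>u \<Sigma>v where "\<Sigma>u = (\<Sum>y\<in>X. ?I X y (?l x A))" and "\<Sigma>v = (\<Sum>y\<in>X. ?I X y A)"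
  have "(\<Sum>y\<in>insert x X. ?I (insert x X) y A) = (u - v) + (\<Sum>y\<in>X. ?I (insert x X) y A)"
    using insert(1,2) by (simp add: u_def v_def)
  also have "(\<Sum>y\<in>X. ?I (insert x X) y A) = (\<Sum>y\<in>X. (?I X y (?l x A) + ?I X y A) / 2)"
    by (rule sum.cong[OF refl I])
  also have "\<dots> = (\<Sigma>u + \<Sigma>v) / 2"
    unfolding \<Sigma>u_def \<Sigma>v_def by (simp only: sum_divide_distrib sum.distrib add_divide_distrib)
  finally have eq: "(\<Sum>y\<in>insert x X. ?I (insert x X) y A) = (u - v) + (\<Sigma>u + \<Sigma>v) / 2" .
  have "4 * u * (1 - u) \<le> \<Sigma>u" "4 * v * (1 - v) \<le> \<Sigma>v"
    unfolding u_def v_def \<Sigma>u_def \<Sigma>v_def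
    by (rule insert.IH[OF up_closed_link[OF insert.prems]], rule insert.IH[OF insert.prems])
  then have "(u - v) + (4 * u * (1 - u) + 4 * v * (1 - v)) / 2 \<le> (\<Sum>y\<in>insert x X. ?I (insert x X) y A)"
    unfolding eq by simp
  moreover have "4 * ((u + v) / 2) * (1 - (u + v) / 2)
      = (u - v) + (4 * u * (1 - u) + 4 * v * (1 - v)) / 2 - (u - v) * (1 - (u - v))"
    by (simp add: field_simps)
  moreover have "0 \<le> (u - v) * (1 - (u - v))" using uv by simp
  moreover have m: "bmeas (1/2) (insert x X) A = (u + v) / 2"
    by (simp add: bmeas_insert[OF insert(1,2)] u_def v_def field_simps)
  ultimately show ?case unfolding m by linarith
qed

section \<open>Stability of intersecting families\<close>

lemma powr_Suc_diff_bounds: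
  fixes x c :: real
  assumes "x > 0" "c \<ge> 1"
  shows "c * x powr (c - 1) \<le> (x + 1) powr c - x powr c"
    and "(x + 1) powr c - x powr c \<le> c * (x + 1) powr (c - 1)"
proof -
  have "\<exists>z. x < z \<and> z < x + 1 \<and> (x + 1) powr c - x powr c = (x + 1 - x) * (c * z powr (c - 1))"
  proof (rule MVT2)
    fix y assume "x \<le> y" "y \<le> x + 1"
    then show "((\<lambda>x. x powr c) has_real_derivative c * y powr (c - 1)) (at y)"
      using assms by (auto intro!: derivative_eq_intros)
  qed simp
  then obtain z where z: "x < z" "z < x + 1" "(x + 1) powr c - x powr c = c * z powr (c - 1)"
    by auto
  show "c * x powr (c - 1) \<le> (x + 1) powr c - x powr c"
    unfolding z(3) using z assms by (intro mult_left_mono powr_mono2) auto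
  show "(x + 1) powr c - x powr c \<le> c * (x + 1) powr (c - 1)"
    unfolding z(3) using z assms by (intro mult_left_mono powr_mono2) auto
qed

text \<open>The deficit at \<open>1/4\<close> equals
  \<open>p * p * p * (4 powr c - 3 powr c - 2 powr c + 1)\<close>. The mean value theorem bounds the
  bracket below by \<open>c * (3 powr (c - 1) - 2 powr (c - 1))\<close>, hence by
  \<open>(c - 1) * ln (3/2)\<close>, which is at least \<open>(c - 1) / 3\<close>;
  \<open>p \<ge> 1/4\<close> contributes the remaining \<open>1/64\<close>.\<close>

lemma quarter_gap:
  fixes c :: real
  assumes c: "1 \<le> c" "c \<le> 2"
  defines "p \<equiv> 2 powr (-c)"
  shows "(c - 1) / 192 \<le> p - (p * (3/4) powr c + (1 - p) * (1/4) powr c)"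
proof -
  have "(c - 1) / 3 \<le> (c - 1) * ln (3/2)"
  proof -
    have "ln (2/3 :: real) \<le> 2/3 - 1" by (rule ln_le_minus_one) simp
    moreover have "ln (3/2 :: real) = - ln (2/3)" by (simp add: ln_div)
    ultimately show ?thesis using c mult_left_mono[of "1/3" "ln (3/2 :: real)" "c - 1"] by simp
  qed
  also have "\<dots> \<le> (3/2) powr (c - 1) - 1"
  proof -
    have "(3/2) powr (c - 1) = exp ((c - 1) * ln (3/2))" by (simp add: powr_def)
    then show ?thesis using exp_ge_add_one_self[of "(c - 1) * ln (3/2)"] by linarith
  qed
  also have "\<dots> \<le> 2 powr (c - 1) * ((3/2) powr (c - 1) - 1)"
  proof -
    have "1 \<le> (2::real) powr (c - 1)" "1 \<le> (3/2::real) powr (c - 1)"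
      using c by (auto intro!: ge_one_powr_ge_zero)
    then show ?thesis
      using mult_right_mono[of 1 "2 powr (c - 1)" "(3/2) powr (c - 1) - 1"] by simp
  qed
  also have "\<dots> = 3 powr (c - 1) - 2 powr (c - 1)"
    by (simp add: powr_divide field_simps)
  also have "\<dots> \<le> c * (3 powr (c - 1) - 2 powr (c - 1))"
  proof -
    have "(2::real) powr (c - 1) \<le> 3 powr (c - 1)" using c by (intro powr_mono2) auto
    then show ?thesis
      using c mult_right_mono[of 1 c "3 powr (c - 1) - 2 powr (c - 1)"] by simp
  qed
  also have "\<dots> \<le> 4 powr c - 3 powr c - 2 powr c + 1"
    using powr_Suc_diff_bounds(1)[of 3 c] powr_Suc_diff_bounds(2)[of 1 c] c
    by (simp add: right_diff_distrib)
  finally have *: "(c - 1) / 3 \<le> 4 powr c - 3 powr c - 2 powr c + 1" .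
  have p: "1/4 \<le> p"
  proof -
    have "(2::real) powr (-2) \<le> p" unfolding p_def using c by (intro powr_mono) auto
    then show ?thesis by (simp add: powr_minus)
  qed
  have f: "(4::real) powr c = 2 powr c * 2 powr c"
    using powr_mult[of 2 2 c] by simp
  have p2: "p * 2 powr c = 1" unfolding p_def by (simp add: powr_minus)
  have h: "p = (1/2) powr c" unfolding p_def by (simp add: powr_divide powr_minus_divide)
  have q: "(1/4::real) powr c = p * p"
    unfolding h using powr_mult[of "1/2" "1/2" c] by simp
  have q3: "(3/4::real) powr c = 3 powr c * (p * p)"
    unfolding q[symmetric] using powr_mult[of 3 "1/4" c] by simp
  have "p - (p * (3/4) powr c + (1 - p) * (1/4) powr c)
      = p * p * p * (4 powr c - 3 powr c - 2 powr c + 1)"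
  proof -
    have "p * p * p * (2 powr c * 2 powr c) = p * (p * 2 powr c) * (p * 2 powr c)"
      "p * p * p * 2 powr c = p * p * (p * 2 powr c)"
      by (simp_all only: ac_simps)
    then have e: "p * p * p * (2 powr c * 2 powr c) = p" "p * p * p * 2 powr c = p * p"
      unfolding p2 by simp_all
    show ?thesis
      unfolding q q3 f right_diff_distrib distrib_left[of "p * p * p"] e by (simp add: algebra_simps)
  qed
  moreover have "1/4 * (1/4) * (1/4) * ((c - 1) / 3) \<le> p * p * p * (4 powr c - 3 powr c - 2 powr c + 1)"
    using p c * by (intro mult_mono) auto
  ultimately show ?thesis by simp
qed

lemma powr_convexD:
  fixes x y t c :: real
  assumes "c \<ge> 1" "x > 0" "y > 0" "0 \<le> t" "t \<le> 1"
  shows "((1 - t) * x + t * y) powr c \<le> (1 - t) * x powr c + t * y powr c"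
  using convex_onD[OF powr_convex[OF assms(1)] assms(4,5), of x y] assms by simp

text \<open>
  The left-hand side is convex in \<open>b\<close> and equals \<open>p\<close> at \<open>0\<close> and \<open>1/2\<close>, so its deficit on
  \<open>[0, 1/2]\<close> is controlled by the one at \<open>1/4\<close>.
\<close>
lemma section_gap:
  fixes c b :: real
  assumes c: "1 \<le> c" "c \<le> 2" and b: "0 \<le> b" "b \<le> 1/2"
  defines "p \<equiv> 2 powr (-c)"
  shows "p * (1 - b) powr c + (1 - p) * b powr c \<le> p - min b (1/2 - b) * ((c - 1) / 48)"
proof -
  define g where "g = p - (p * (3/4) powr c + (1 - p) * (1/4) powr c)"
  have g: "(c - 1) / 192 \<le> g" unfolding g_def p_def by (rule quarter_gap[OF c])
  have p: "0 \<le> p" "p \<le> 1" unfolding p_def using c by (auto simp: powr_minus field_simps ge_one_powr_ge_zero)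
  have "p * (1 - b) powr c + (1 - p) * b powr c \<le> p - 4 * min b (1/2 - b) * g"
  proof (cases "b \<le> 1/4")
    case True
    have 1: "(1 - b) powr c \<le> (1 - 4 * b) + 4 * b * (3/4) powr c"
      using powr_convexD[of c 1 "3/4" "4 * b"] c b True by (simp add: algebra_simps)
    \<comment> \<open>At the endpoint \<open>0\<close> the positivity required by
      \<open>powr_convexD\<close> fails, so the chord bound for \<open>b powr c\<close> is obtained
      directly from \<open>(4 * b) powr c \<le> 4 * b\<close>.\<close>
    have "(4 * b) powr c \<le> 4 * b"
      using b True c by (cases "b = 0") (auto intro!: powr_le_one_le)
    then have "(4 * b) powr c * (1/4) powr c \<le> 4 * b * (1/4) powr c"
      using b by (intro mult_right_mono) auto
    moreover have "(4 * b) powr c * (1/4) powr c = b powr c"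
      using b by (subst powr_mult[symmetric]) auto
    ultimately have 2: "b powr c \<le> 4 * b * (1/4) powr c" by simp
    have "p * (1 - b) powr c + (1 - p) * b powr c
        \<le> p * ((1 - 4 * b) + 4 * b * (3/4) powr c) + (1 - p) * (4 * b * (1/4) powr c)"
      using 1 2 p by (intro add_mono mult_left_mono) auto
    also have "\<dots> = p - 4 * b * g" by (simp add: g_def algebra_simps)
    finally show ?thesis using True by (simp add: min_def)
  next
    case False
    \<comment> \<open>The weight of \<open>1/4\<close> when \<open>b\<close> is interpolated between
      \<open>1/2\<close> and \<open>1/4\<close>. It equals \<open>4 * (1/2 - b)\<close>, and this
      factor \<open>4\<close> turns \<open>1/192\<close> into \<open>1/48\<close>.\<close>
    define t where "t = 2 - 4 * b"
    have t: "0 \<le> t" "t \<le> 1" using b False by (auto simp: t_def)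
    have e: "1 - b = (1 - t) * (1/2) + t * (3/4)" "b = (1 - t) * (1/2) + t * (1/4)"
      by (auto simp: t_def field_simps)
    have 1: "(1 - b) powr c \<le> (1 - t) * (1/2) powr c + t * (3/4) powr c"
      unfolding e(1) using c t by (intro powr_convexD) auto
    have 2: "b powr c \<le> (1 - t) * (1/2) powr c + t * (1/4) powr c"
      by (subst e(2)) (use c t in \<open>intro powr_convexD, auto\<close>)
    have h: "(1/2::real) powr c = p" unfolding p_def by (simp add: powr_divide powr_minus field_simps)
    have "p * (1 - b) powr c + (1 - p) * b powr c
        \<le> p * ((1 - t) * (1/2) powr c + t * (3/4) powr c) + (1 - p) * ((1 - t) * (1/2) powr c + t * (1/4) powr c)"
      using 1 2 p by (intro add_mono mult_left_mono) auto
    also have "\<dots> = p - t * g" unfolding h g_def by (simp add: algebra_simps)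
    finally show ?thesis using False by (simp add: min_def t_def)
  qed
  also have "\<dots> \<le> p - 4 * min b (1/2 - b) * ((c - 1) / 192)"
    using g b by (intro diff_left_mono mult_left_mono) auto
  finally show ?thesis by (simp add: mult_ac)
qed

lemma bmeas_half_complement:
  assumes "finite X"
  shows "bmeas (1/2) X {S. X - S \<in> A} = bmeas (1/2) X A"
proof -
  have half: "bmeas (1/2) X B = card (Pow X \<inter> B) / 2 ^ card X" for B :: "'a set set"
  proof -
    have "bmeas (1/2) X B = (\<Sum>S\<in>Pow X \<inter> B. (1/2) ^ card X)"
      unfolding bmeas_def
    proof (intro sum.cong refl)
      fix S assume "S \<in> Pow X \<inter> B"
      then have "card S \<le> card X" using assms by (auto intro: card_mono)
      then show "(1/2) ^ card S * (1 - 1/2) ^ (card X - card S) = (1/2::real) ^ card X"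
        by (simp add: power_add[symmetric] flip: power_add)
    qed
    then show ?thesis by (simp add: power_one_over)
  qed
  have "card (Pow X \<inter> {S. X - S \<in> A}) = card (Pow X \<inter> A)"
    by (rule bij_betw_same_card[of "\<lambda>S. X - S"], rule bij_betw_byWitness[where f'="\<lambda>S. X - S"])
       (auto simp: double_diff)
  then show ?thesis by (simp add: half)
qed

text \<open>If \<open>insert x S\<close> lies in \<open>A\<close>, the complement of
  \<open>S\<close> in \<open>X - {x}\<close> does not, being disjoint from it; and complementation
  preserves the measure at \<open>1/2\<close>.\<close>

lemma intersecting_sections_sum_le_1:
  assumes X: "finite X" and x: "x \<in> X" and A: "intersecting A"
  shows "bmeas (1/2) (X - {x}) {S. insert x S \<in> A} + bmeas (1/2) (X - {x}) A \<le> 1"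
proof -
  let ?Y = "X - {x}"
  have "bmeas (1/2) ?Y {S. insert x S \<in> A} \<le> bmeas (1/2) ?Y (- {S. ?Y - S \<in> A})"
  proof (rule bmeas_mono)
    show "Pow ?Y \<inter> {S. insert x S \<in> A} \<subseteq> - {S. ?Y - S \<in> A}"
      using A unfolding intersecting_def by fastforce
  qed (use X in auto)
  also have "\<dots> = 1 - bmeas (1/2) ?Y A"
    using X bmeas_half_complement[of ?Y A] by (simp add: bmeas_Compl)
  finally show ?thesis by simp
qed

text \<open>At \<open>1/2\<close> the average of the two sections is at most \<open>1/2\<close>, and
  \<open>bmeas_le_half_powr\<close> transfers this to \<open>2 powr (-c)\<close>. Over the empty
  ground set the bound holds because an intersecting family cannot contain
  \<open>{}\<close>.\<close>

lemma intersecting_bmeas_le: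
  fixes c :: real
  assumes c: "c \<ge> 1" and X: "finite X" and A: "up_closed A" "intersecting A"
  shows "bmeas (2 powr (-c)) X A \<le> 2 powr (-c)"
proof -
  have half: "bmeas (1/2) X A \<le> 1/2"
  proof (cases "X = {}")
    case True
    have "{} \<notin> A" using A(2) unfolding intersecting_def by blast
    then show ?thesis by (simp add: True bmeas_empty_ground)
  next
    case False
    then obtain x where x: "x \<in> X" by blast
    show ?thesis
      using intersecting_sections_sum_le_1[OF X x A(2)] bmeas_split[OF X x, of "1/2" A] by simp
  qed
  have "bmeas (2 powr (-c)) X A \<le> bmeas (1/2) X A powr c"
    by (rule bmeas_le_half_powr[OF c X A(1)])
  also have "\<dots> \<le> (1/2) powr c"
    using half c by (intro powr_mono2 bmeas_nonneg) auto
  finally show ?thesis by (simp add: powr_divide powr_minus field_simps)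
qed

lemma intersecting_stability:
  fixes c e :: real
  assumes c: "1 < c" "c \<le> 2" and X: "finite X" "X \<noteq> {}"
    and A: "up_closed A" "intersecting A"
    and large: "2 powr (-c) - e \<le> bmeas (2 powr (-c)) X A"
    and small: "192 * real (card X) * e < c - 1"
  shows "\<exists>x\<in>X. bmeas (1/2) (X - {x}) A \<le> 48 * e / (c - 1)"
proof (rule ccontr)
  assume contr: "\<not> ?thesis"
  define p :: real where "p = 2 powr (-c)"
  \<comment> \<open>The threshold at which the deficit \<open>t * ((c - 1) / 48)\<close> from
    \<open>section_gap\<close> equals the allowed \<open>e\<close>.\<close>
  define t where "t = 48 * e / (c - 1)"
  have p: "0 \<le> p" "p \<le> 1" unfolding p_def using c by (auto simp: powr_minus field_simps ge_one_powr_ge_zero)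
  define \<alpha> where "\<alpha> = bmeas (1/2) X A"
  have infl: "bmeas (1/2) (X - {x}) {S. insert x S \<in> A} - bmeas (1/2) (X - {x}) A \<le> 2 * t"
     and al: "1/2 - t \<le> \<alpha>" "\<alpha> \<le> 1/2" if x: "x \<in> X" for x
  proof -
    define u v where "u = bmeas (1/2) (X - {x}) {S. insert x S \<in> A}" and "v = bmeas (1/2) (X - {x}) A"
    have fin: "finite (X - {x})" using X by simp
    have uv: "0 \<le> v" "v \<le> u" "u + v \<le> 1"
      unfolding u_def v_def using A fin intersecting_sections_sum_le_1[OF X(1) x A(2)]
      by (auto intro!: bmeas_nonneg bmeas_link_ge)
    have av: "\<alpha> = (u + v) / 2"
      unfolding \<alpha>_def u_def v_def using bmeas_split[OF X(1) x, of "1/2" A] by simp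
    have "p - e \<le> bmeas p X A" using large by (simp add: p_def)
    also have "\<dots> = p * bmeas p (X - {x}) {S. insert x S \<in> A} + (1 - p) * bmeas p (X - {x}) A"
      by (rule bmeas_split[OF X(1) x])
    also have "\<dots> \<le> p * u powr c + (1 - p) * v powr c"
      unfolding u_def v_def using p c fin A unfolding p_def
      by (intro add_mono mult_left_mono bmeas_le_half_powr) (auto intro: up_closed_link)
    also have "\<dots> \<le> p * (1 - v) powr c + (1 - p) * v powr c"
      using uv p c by (intro add_mono mult_left_mono powr_mono2) auto
    also have "\<dots> \<le> p - min v (1/2 - v) * ((c - 1) / 48)"
      unfolding p_def using uv c by (intro section_gap) auto
    finally have "min v (1/2 - v) \<le> t" using c by (simp add: t_def field_simps)
    moreover have "\<not> v \<le> t" using contr x by (auto simp: v_def t_def)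
    \<comment> \<open>The lower section is not below the threshold, so it must be near
      \<open>1/2\<close>. As both sections sum to at most \<open>1\<close>, the influence
      \<open>u - v\<close> is then at most \<open>1 - 2 * v\<close>.\<close>
    ultimately have v: "1/2 - t \<le> v" by auto
    show "bmeas (1/2) (X - {x}) {S. insert x S \<in> A} - bmeas (1/2) (X - {x}) A \<le> 2 * t"
      using v uv unfolding u_def[symmetric] v_def[symmetric] by simp
    show "1/2 - t \<le> \<alpha>" "\<alpha> \<le> 1/2" using v uv by (auto simp: av)
  qed
  have n: "card X \<ge> 1" using X by (simp add: Suc_leI card_gt_0_iff)
  have nt: "4 * card X * t < 1" using small c by (simp add: t_def field_simps)
  have t4: "t < 1/4"
  proof (rule ccontr)
    assume "\<not> t < 1/4"
    then have "1 * (1/4) \<le> real (card X) * t" using n by (intro mult_mono) auto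
    then show False using nt by simp
  qed
  obtain x0 where x0: "x0 \<in> X" using X by blast
  \<comment> \<open>Poincare forces total influence at least
    \<open>2 * \<alpha> \<ge> 1 - 2 * t > 1/2\<close>, whereas influences of at most
    \<open>2 * t\<close> in every direction add up to less than \<open>1/2\<close>.\<close>
  have "2 * \<alpha> \<le> 4 * \<alpha> * (1 - \<alpha>)"
    using al[OF x0] t4 mult_left_mono[of "1/2" "1 - \<alpha>" "4 * \<alpha>"] by simp
  also have "\<dots> \<le> (\<Sum>x\<in>X. bmeas (1/2) (X - {x}) {S. insert x S \<in> A} - bmeas (1/2) (X - {x}) A)"
    unfolding \<alpha>_def by (rule poincare_inequality[OF X(1) A(1)])
  also have "\<dots> \<le> (\<Sum>x\<in>X. 2 * t)" by (intro sum_mono infl)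
  finally have "2 * \<alpha> \<le> 2 * card X * t" by simp
  then show False using al[OF x0] t4 nt by linarith
qed

section \<open>Levels and tails\<close>

lemma bmeas_levels:
  assumes "finite X"
  shows "bmeas p X A = (\<Sum>j\<le>card X. p ^ j * (1 - p) ^ (card X - j) * card (A \<inter> [X]\<^bsup>j\<^esup>))"
proof -
  let ?w = "\<lambda>S. p ^ card S * (1 - p) ^ (card X - card S)"
  have "bmeas p X A = (\<Sum>j\<le>card X. \<Sum>S\<in>{S \<in> Pow X \<inter> A. card S = j}. ?w S)"
    unfolding bmeas_def using assms by (intro sum.group[symmetric]) (auto intro: card_mono)
  also have "\<dots> = (\<Sum>j\<le>card X. p ^ j * (1 - p) ^ (card X - j) * card (A \<inter> [X]\<^bsup>j\<^esup>))"
  proof (intro sum.cong refl)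
    fix j
    have "{S \<in> Pow X \<inter> A. card S = j} = A \<inter> [X]\<^bsup>j\<^esup>"
      using assms by (auto simp: nsets_def intro: finite_subset)
    then show "(\<Sum>S\<in>{S \<in> Pow X \<inter> A. card S = j}. ?w S)
        = p ^ j * (1 - p) ^ (card X - j) * card (A \<inter> [X]\<^bsup>j\<^esup>)"
      by (simp add: nsets_def)
  qed
  finally show ?thesis .
qed

text \<open>Markov's inequality for \<open>z ^ card S\<close>: since \<open>z \<le> 1\<close> it is
  at least \<open>z ^ k\<close> on sets with fewer than \<open>k\<close> points, and its expectation
  is given by the binomial theorem.\<close>

lemma bmeas_tail_mgf:
  fixes z :: real
  assumes p: "0 \<le> p" "p \<le> 1" and X: "finite X" and z: "0 < z" "z \<le> 1"
  shows "z ^ k * bmeas p X {S. card S < k} \<le> (1 - p + p * z) ^ card X"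
proof -
  let ?n = "card X"
  let ?T = "{S. card S < k}"
  have "z ^ k * bmeas p X ?T
      = (\<Sum>j\<le>?n. p ^ j * (1 - p) ^ (?n - j) * (z ^ k * card (?T \<inter> [X]\<^bsup>j\<^esup>)))"
    unfolding bmeas_levels[OF X] sum_distrib_left by (simp add: mult_ac)
  also have "\<dots> \<le> (\<Sum>j\<le>?n. p ^ j * (1 - p) ^ (?n - j) * (z ^ j * (?n choose j)))"
  proof (intro sum_mono mult_left_mono)
    fix j
    show "z ^ k * card (?T \<inter> [X]\<^bsup>j\<^esup>) \<le> z ^ j * (?n choose j)"
    proof (cases "j < k")
      case True
      have "card (?T \<inter> [X]\<^bsup>j\<^esup>) \<le> card ([X]\<^bsup>j\<^esup>)"
        using X by (intro card_mono finite_imp_finite_nsets) auto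
      then have "real (card (?T \<inter> [X]\<^bsup>j\<^esup>)) \<le> ?n choose j" using X by simp
      moreover have "z ^ k \<le> z ^ j" using True z by (intro power_decreasing) auto
      ultimately show ?thesis using z by (intro mult_mono) auto
    next
      case False
      then have "?T \<inter> [X]\<^bsup>j\<^esup> = {}" by (auto simp: nsets_def)
      then show ?thesis using z by simp
    qed
  qed (use p in auto)
  also have "\<dots> = (\<Sum>j\<le>?n. (?n choose j) * (p * z) ^ j * (1 - p) ^ (?n - j))"
    by (simp add: power_mult_distrib mult_ac)
  also have "\<dots> = (p * z + (1 - p)) ^ ?n"
    by (rule binomial_ring[symmetric])
  finally show ?thesis by (simp add: add.commute)
qed

lemma exp_minus_le_quadratic:
  fixes x :: real
  assumes "x \<ge> 0"
  shows "exp (-x) \<le> 1 - x + x\<^sup>2 / 2"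
proof -
  have pos: "0 < 1 + x + x\<^sup>2 / 2" using assms by (simp add: add_pos_nonneg)
  have "exp (-x) = 1 / exp x" by (simp add: exp_minus inverse_eq_divide)
  also have "\<dots> \<le> 1 / (1 + x + x\<^sup>2 / 2)"
    using exp_lower_Taylor_quadratic[OF assms] pos by (intro divide_left_mono) auto
  also have "\<dots> \<le> 1 - x + x\<^sup>2 / 2"
  proof -
    have "(1 - x + x\<^sup>2 / 2) * (1 + x + x\<^sup>2 / 2) = 1 + x ^ 4 / 4"
      by (simp add: algebra_simps power2_eq_square power4_eq_xxxx)
    then show ?thesis using pos by (simp add: divide_le_eq)
  qed
  finally show ?thesis .
qed

lemma bmeas_tail_le:
  fixes p s :: real
  assumes p: "0 \<le> p" "p \<le> 1/2" and X: "finite X" "X \<noteq> {}" and s: "0 \<le> s" "real k + s \<le> card X * p"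
  shows "bmeas p X {S. card S < k} \<le> exp (- (s\<^sup>2 / card X))"
proof -
  define n where "n = card X"
  have n: "n > 0" using X by (simp add: n_def card_gt_0_iff)
  \<comment> \<open>This minimises \<open>- s * l + n * l\<^sup>2 / 4\<close>, the exponent that
    remains after using \<open>p \<le> 1/2\<close>.\<close>
  define l where "l = 2 * s / n"
  have l: "l \<ge> 0" using s by (simp add: l_def)
  have "exp (-l) ^ k * bmeas p X {S. card S < k} \<le> (1 - p + p * exp (-l)) ^ n"
    unfolding n_def using p X l by (intro bmeas_tail_mgf) auto
  also have "\<dots> \<le> exp (- p * (l - l\<^sup>2 / 2)) ^ n"
  proof (intro power_mono)
    have "p * exp (-l) \<le> p * (1 - l + l\<^sup>2 / 2)"
      using exp_minus_le_quadratic[OF l] p by (intro mult_left_mono) auto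
    then have "1 - p + p * exp (-l) \<le> 1 + (- p * (l - l\<^sup>2 / 2))" by (simp add: algebra_simps)
    also have "\<dots> \<le> exp (- p * (l - l\<^sup>2 / 2))" by (rule exp_ge_add_one_self)
    finally show "1 - p + p * exp (-l) \<le> exp (- p * (l - l\<^sup>2 / 2))" .
  qed (use p in auto)
  also have "\<dots> = exp (- (n * p * (l - l\<^sup>2 / 2)))"
    by (simp add: exp_of_nat_mult[symmetric] mult_ac)
  finally have "exp (- (k * l)) * bmeas p X {S. card S < k} \<le> exp (- (n * p * (l - l\<^sup>2 / 2)))"
    by (simp add: exp_of_nat_mult[symmetric])
  then have "exp (k * l) * (exp (- (k * l)) * bmeas p X {S. card S < k})
      \<le> exp (k * l) * exp (- (n * p * (l - l\<^sup>2 / 2)))"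
    by (rule mult_left_mono) simp
  then have "bmeas p X {S. card S < k} \<le> exp (k * l - n * p * (l - l\<^sup>2 / 2))"
    by (simp add: mult.assoc[symmetric] exp_add[symmetric])
  also have "\<dots> \<le> exp (- (s\<^sup>2 / n))"
  proof -
    have "k * l - n * p * (l - l\<^sup>2 / 2) = (k - n * p) * l + n * p * l\<^sup>2 / 2"
      by (simp add: algebra_simps)
    also have "\<dots> \<le> (- s) * l + n * (1/2) * l\<^sup>2 / 2"
      using s p l unfolding n_def
      by (intro add_mono mult_right_mono divide_right_mono mult_left_mono) auto
    also have "\<dots> = - (s\<^sup>2 / n)"
      using n by (simp add: l_def field_simps power2_eq_square)
    finally show ?thesis by simp
  qed
  finally show ?thesis by (simp add: n_def)
qed

text \<open>The model is the family of sets avoiding \<open>card X - N\<close> fixed points: it has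
  \<open>N choose j\<close> sets of size \<open>j\<close> and measure
  \<open>(1 - p) ^ (card X - N)\<close>. From level \<open>k\<close> on, \<open>level_ratio\<close>
  bounds \<open>D\<close> by \<open>\<theta>\<close> times the model; the levels below
  \<open>k\<close> are left to the tail.\<close>

lemma bmeas_down_closed_le:
  fixes \<theta> :: real
  assumes D: "down_closed D" and X: "finite X" and k: "1 \<le> k" and N: "N \<le> card X"
    and p: "0 \<le> p" "p \<le> 1" and th: "0 \<le> \<theta>" "\<theta> \<le> 1"
    and le: "card (D \<inter> [X]\<^bsup>k\<^esup>) \<le> \<theta> * (N choose k)"
  shows "bmeas p X D \<le> bmeas p X {S. card S < k} + \<theta> * (1 - p) ^ (card X - N)"
proof -
  let ?n = "card X"
  let ?L = "{S. card S < k}"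
  have "card (D \<inter> [X]\<^bsup>k\<^esup>) \<le> 1 * real (N choose k)"
    using le th by (meson mult_right_mono of_nat_0_le_iff order_trans)
  then have le1: "card (D \<inter> [X]\<^bsup>k\<^esup>) \<le> N choose k" by simp
  have lev: "card (D \<inter> [X]\<^bsup>j\<^esup>) \<le> \<theta> * (N choose j)" if j: "k \<le> j" for j
  proof (cases "N choose k = 0")
    case True
    then have "N choose j = 0" using j by (simp add: binomial_eq_0_iff)
    then show ?thesis using level_ratio(1)[OF D X k j le1] th by (metis le_zero_eq mult_zero_right of_nat_0 order_refl)
  next
    case False
    have "real (card (D \<inter> [X]\<^bsup>j\<^esup>)) * (N choose k) \<le> real (card (D \<inter> [X]\<^bsup>k\<^esup>)) * (N choose j)"
      using level_ratio(2)[OF D X k j le1] by (metis of_nat_le_iff of_nat_mult)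
    also have "\<dots> \<le> \<theta> * (N choose k) * (N choose j)"
      using le by (intro mult_right_mono) auto
    finally show ?thesis using False by (simp add: mult_ac)
  qed
  have "bmeas p X D \<le> bmeas p X (?L \<union> (D - ?L))"
    using p X by (intro bmeas_mono) auto
  also have "\<dots> \<le> bmeas p X ?L + bmeas p X (D - ?L)"
    using p X by (intro bmeas_Un_le) auto
  also have "bmeas p X (D - ?L) \<le> (\<Sum>j\<le>?n. p ^ j * (1 - p) ^ (?n - j) * (\<theta> * (N choose j)))"
    unfolding bmeas_levels[OF X]
  proof (intro sum_mono mult_left_mono)
    fix j
    show "card ((D - ?L) \<inter> [X]\<^bsup>j\<^esup>) \<le> \<theta> * (N choose j)"
    proof (cases "k \<le> j")
      case True
      then have "(D - ?L) \<inter> [X]\<^bsup>j\<^esup> = D \<inter> [X]\<^bsup>j\<^esup>" by (auto simp: nsets_def)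
      then show ?thesis using lev[OF True] by simp
    next
      case False
      then have "(D - ?L) \<inter> [X]\<^bsup>j\<^esup> = {}" by (auto simp: nsets_def)
      then show ?thesis using th by simp
    qed
  qed (use p in auto)
  also have "(\<Sum>j\<le>?n. p ^ j * (1 - p) ^ (?n - j) * (\<theta> * (N choose j)))
      = (\<Sum>j\<le>N. p ^ j * (1 - p) ^ (?n - j) * (\<theta> * (N choose j)))"
    using N by (intro sum.mono_neutral_right) auto
  also have "\<dots> = (\<Sum>j\<le>N. \<theta> * (1 - p) ^ (?n - N) * ((N choose j) * p ^ j * (1 - p) ^ (N - j)))"
  proof (intro sum.cong refl)
    fix j assume "j \<in> {..N}"
    then have "?n - j = (?n - N) + (N - j)" using N by auto
    then show "p ^ j * (1 - p) ^ (?n - j) * (\<theta> * (N choose j))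
        = \<theta> * (1 - p) ^ (?n - N) * ((N choose j) * p ^ j * (1 - p) ^ (N - j))"
      by (simp add: power_add mult_ac)
  qed
  also have "\<dots> = \<theta> * (1 - p) ^ (?n - N) * (p + (1 - p)) ^ N"
    unfolding sum_distrib_left[symmetric] binomial_ring by simp
  finally show ?thesis by simp
qed

section \<open>Unions of intersecting families\<close>

definition up_closure :: "'a set set \<Rightarrow> 'a set set" where
  "up_closure G = {S. \<exists>A\<in>G. A \<subseteq> S}"

lemma up_closed_up_closure: "up_closed (up_closure G)"
  unfolding up_closed_def up_closure_def by blast

lemma intersecting_up_closure: "intersecting G \<Longrightarrow> intersecting (up_closure G)"
  unfolding intersecting_def up_closure_def by blast

lemma up_closure_level:
  assumes "G \<subseteq> [X]\<^bsup>k\<^esup>" "S \<in> [X]\<^bsup>k\<^esup>"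
  shows "S \<in> up_closure G \<longleftrightarrow> S \<in> G"
proof
  assume "S \<in> up_closure G"
  then obtain A where "A \<in> G" "A \<subseteq> S" by (auto simp: up_closure_def)
  moreover from this assms have "card A = card S" "finite S" by (auto simp: nsets_def)
  ultimately show "S \<in> G" using card_subset_eq by blast
qed (auto simp: up_closure_def)

text \<open>Harris' inequality, with the other factors bounded below by \<open>1 - p\<close>, leaves
  each up-closure a deficit of at most \<open>2 ^ r * T\<close>, to which stability applies. The
  resulting bound on a section measure becomes a count of \<open>k\<close>-sets by a second use of
  \<open>bmeas_down_closed_le\<close>, inside \<open>X - {x}\<close>.\<close>

lemma near_extremal_imp_near_star:
  fixes c T :: real
  assumes c: "1 < c" "c \<le> 2" and X: "finite X" "X \<noteq> {}" and k: "1 \<le> k"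
    and I: "finite I" "card I = r" "r \<le> card X"
    and G: "\<And>i. i \<in> I \<Longrightarrow> G i \<subseteq> [X]\<^bsup>k\<^esup>" "\<And>i. i \<in> I \<Longrightarrow> intersecting (G i)"
    and large: "(card X choose k) \<le> card (\<Union>i\<in>I. G i) + (card X - r choose k)"
    and T: "T = bmeas (2 powr (-c)) X {S. card S < k}"
    and small: "192 * real (card X) * (2 ^ r * T) < c - 1"
    and i: "i \<in> I"
  shows "\<exists>x\<in>X. card {S \<in> G i. x \<notin> S} \<le> (48 * (2 ^ r * T) / (c - 1) + 2 * T) * (card X - 1 choose k)"
proof -
  define p :: real where "p = 2 powr (-c)"
  have p: "0 \<le> p" "p \<le> 1/2"
  proof -
    show "0 \<le> p" by (simp add: p_def)
    have "p \<le> 2 powr (-1)" unfolding p_def using c by (intro powr_mono) auto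
    then show "p \<le> 1/2" by (simp add: powr_minus)
  qed
  then have p1: "p \<le> 1" by simp
  let ?n = "card X"
  let ?U = "\<lambda>i. up_closure (G i)"
  define D where "D = (\<Inter>i\<in>I. - ?U i)"
  have Tp: "T = bmeas p X {S. card S < k}" by (simp add: T p_def)
  have T0: "0 \<le> T" unfolding Tp using p by (intro bmeas_nonneg) auto
  have dcU: "down_closed (- ?U j)" for j
    by (intro down_closed_Compl up_closed_up_closure)
  have dcD: "down_closed D"
    unfolding D_def using dcU unfolding down_closed_def by blast
  have finG: "finite (\<Union>i\<in>I. G i)"
    using G(1) X by (meson UN_least finite_imp_finite_nsets finite_subset)
  \<comment> \<open>At level \<open>k\<close> the up-closures reduce to the families themselves, so
    this level of \<open>D\<close> is what the union leaves uncovered.\<close>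
  have "D \<inter> [X]\<^bsup>k\<^esup> = [X]\<^bsup>k\<^esup> - (\<Union>i\<in>I. G i)"
    unfolding D_def using up_closure_level[OF G(1)] by blast
  then have "card (D \<inter> [X]\<^bsup>k\<^esup>) = (?n choose k) - card (\<Union>i\<in>I. G i)"
    using finG G(1) X by (subst card_Diff_subset[symmetric, of "\<Union>i\<in>I. G i" "[X]\<^bsup>k\<^esup>", unfolded card_nsets]) auto
  then have "card (D \<inter> [X]\<^bsup>k\<^esup>) \<le> 1 * real (?n - r choose k)"
    using large by simp
  from bmeas_down_closed_le[OF dcD X(1) k _ p(1) p1 _ _ this]
  have upper: "bmeas p X D \<le> T + (1 - p) ^ r"
    using I by (simp add: Tp)
  have lower: "1 - p \<le> bmeas p X (- ?U j)" if "j \<in> I" for j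
    using intersecting_bmeas_le[of c X "?U j"] c X G(2)[OF that]
    by (simp add: bmeas_Compl p_def up_closed_up_closure intersecting_up_closure)
  have "(1 - p) ^ (r - 1) * bmeas p X (- ?U i) \<le> (\<Prod>j\<in>I. bmeas p X (- ?U j))"
  proof -
    have "(\<Prod>j\<in>I - {i}. 1 - p) \<le> (\<Prod>j\<in>I - {i}. bmeas p X (- ?U j))"
      using lower p by (intro prod_mono) auto
    then have "(1 - p) ^ (r - 1) * bmeas p X (- ?U i) \<le> (\<Prod>j\<in>I - {i}. bmeas p X (- ?U j)) * bmeas p X (- ?U i)"
      using I i p by (intro mult_right_mono bmeas_nonneg) auto
    also have "\<dots> = (\<Prod>j\<in>I. bmeas p X (- ?U j))"
      using I i by (simp add: prod.remove[of I i] mult.commute)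
    finally show ?thesis .
  qed
  also have "\<dots> \<le> bmeas p X D"
    unfolding D_def using p I X dcU by (intro harris_inequality_INT) auto
  also note upper
  finally have "(1 - p) ^ (r - 1) * bmeas p X (- ?U i) \<le> T + (1 - p) ^ r" .
  moreover have "r \<ge> 1" using i I by (metis One_nat_def Suc_leI card_gt_0_iff empty_iff)
  then have "(1 - p) ^ r = (1 - p) ^ (r - 1) * (1 - p)" by (metis power_minus_mult Suc_le_eq One_nat_def)
  \<comment> \<open>Cancelling \<open>(1 - p) ^ (r - 1)\<close> inflates the tail by at most
    \<open>2 ^ r\<close>, because \<open>p \<le> 1/2\<close>.\<close>
  moreover have "T \<le> (1 - p) ^ (r - 1) * (2 ^ r * T)"
  proof -
    have "(1/2) ^ r \<le> (1 - p) ^ r" using p by (intro power_mono) auto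
    also have "\<dots> \<le> (1 - p) ^ (r - 1)" using p by (intro power_decreasing) auto
    finally have "1 \<le> (1 - p) ^ (r - 1) * 2 ^ r" by (simp add: power_one_over field_simps)
    then show ?thesis using mult_right_mono[OF _ T0] by fastforce
  qed
  ultimately have "(1 - p) ^ (r - 1) * bmeas p X (- ?U i) \<le> (1 - p) ^ (r - 1) * (2 ^ r * T + (1 - p))"
    by (simp add: distrib_left)
  then have "bmeas p X (- ?U i) \<le> 2 ^ r * T + (1 - p)"
    using p by (subst (asm) mult_le_cancel_left_pos) auto
  then have "2 powr (-c) - 2 ^ r * T \<le> bmeas (2 powr (-c)) X (?U i)"
    using X by (simp add: bmeas_Compl p_def)
  then obtain x where x: "x \<in> X" "bmeas (1/2) (X - {x}) (?U i) \<le> 48 * (2 ^ r * T) / (c - 1)"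
    using intersecting_stability[OF c X up_closed_up_closure intersecting_up_closure[OF G(2)[OF i]] _ small]
    by blast
  let ?Y = "X - {x}"
  let ?N = "{S \<in> G i. x \<notin> S}"
  let ?C = "?n - 1 choose k"
  have Y: "finite ?Y" "card ?Y = ?n - 1" using X x by auto
  have NY: "?N \<subseteq> [?Y]\<^bsup>k\<^esup>" using G(1)[OF i] by (auto simp: nsets_def)
  then have "card ?N \<le> card ([?Y]\<^bsup>k\<^esup>)" by (intro card_mono finite_imp_finite_nsets Y)
  then have cN: "card ?N \<le> ?C" using Y by simp
  show ?thesis
  proof (cases "?C = 0")
    case True
    have "card ?N = 0" using cN True by (metis le_zero_eq)
    show ?thesis
      by (rule bexI[OF _ x(1)]) (simp only: True \<open>card ?N = 0\<close> of_nat_0 mult_zero_right order_refl)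
  next
    case False
    define d where "d = card ?N / ?C"
    have d: "0 \<le> d" "d \<le> 1"
    proof -
      have "real (card ?N) \<le> real ?C" using cN by (rule of_nat_mono)
      then show "0 \<le> d" "d \<le> 1" unfolding d_def by (simp_all only: divide_nonneg_nonneg of_nat_0_le_iff divide_le_eq_1) auto
    qed
    have "- ?U i \<inter> [?Y]\<^bsup>k\<^esup> = [?Y]\<^bsup>k\<^esup> - ?N"
    proof -
      have "S \<in> ?U i \<longleftrightarrow> S \<in> ?N" if "S \<in> [?Y]\<^bsup>k\<^esup>" for S
        using up_closure_level[OF G(1)[OF i], of S] that by (auto simp: nsets_def)
      then show ?thesis by blast
    qed
    then have "card (- ?U i \<inter> [?Y]\<^bsup>k\<^esup>) = ?C - card ?N"
      using NY Y by (simp add: card_Diff_subset finite_subset[OF NY] finite_imp_finite_nsets)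
    then have "card (- ?U i \<inter> [?Y]\<^bsup>k\<^esup>) \<le> (1 - d) * real (card ?Y choose k)"
      using cN False Y by (simp add: d_def field_simps of_nat_diff)
    \<comment> \<open>With \<open>N = card ?Y\<close> the power of \<open>1 - p\<close> disappears
      and the main term is \<open>1 - d\<close>; passing to the complement bounds the density
      \<open>d\<close> by the tail plus the measure of the up-closure.\<close>
    from bmeas_down_closed_le[OF dcU Y(1) k _ p(1) p1 _ _ this]
    have "bmeas p ?Y (- ?U i) \<le> bmeas p ?Y {S. card S < k} + (1 - d)"
      using d by simp
    then have 1: "d \<le> bmeas p ?Y {S. card S < k} + bmeas p ?Y (?U i)"
      using Y by (simp add: bmeas_Compl)
    \<comment> \<open>Conditioning on \<open>x\<close> not being chosen, an event of probability
      \<open>1 - p \<ge> 1/2\<close>, at most doubles the tail.\<close>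
    have "p * bmeas p ?Y {S. insert x S \<in> {S. card S < k}} + (1 - p) * bmeas p ?Y {S. card S < k} = T"
      unfolding Tp by (rule bmeas_split[OF X(1) x(1), symmetric])
    moreover have "0 \<le> p * bmeas p ?Y {S. insert x S \<in> {S. card S < k}}"
      using p by (intro mult_nonneg_nonneg bmeas_nonneg) auto
    moreover have "1/2 * bmeas p ?Y {S. card S < k} \<le> (1 - p) * bmeas p ?Y {S. card S < k}"
      using p by (intro mult_right_mono bmeas_nonneg) auto
    ultimately have 2: "bmeas p ?Y {S. card S < k} \<le> 2 * T" by linarith
    have 3: "bmeas p ?Y (?U i) \<le> 48 * (2 ^ r * T) / (c - 1)"
    proof -
      let ?b = "bmeas (1/2) ?Y (?U i)"
      have b: "0 \<le> ?b" "?b \<le> 1" using Y by (auto intro!: bmeas_nonneg bmeas_le_1)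
      have "bmeas p ?Y (?U i) \<le> ?b powr c"
        unfolding p_def using c Y by (intro bmeas_le_half_powr up_closed_up_closure) auto
      also have "\<dots> \<le> ?b" using b c by (cases "?b = 0") (auto intro!: powr_le_one_le)
      also note x(2)
      finally show ?thesis .
    qed
    have "d \<le> 48 * (2 ^ r * T) / (c - 1) + 2 * T" using 1 2 3 by linarith
    then have "d * ?C \<le> (48 * (2 ^ r * T) / (c - 1) + 2 * T) * ?C"
      by (intro mult_right_mono) auto
    then show ?thesis using False x(1) by (auto simp: d_def)
  qed
qed

section \<open>From near-stars to stars\<close>

lemma card_star:
  assumes "finite X" "R \<subseteq> X"
  shows "card {S \<in> [X]\<^bsup>k\<^esup>. S \<inter> R \<noteq> {}} = (card X choose k) - (card X - card R choose k)"
proof -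
  have "{S \<in> [X]\<^bsup>k\<^esup>. S \<inter> R \<noteq> {}} = [X]\<^bsup>k\<^esup> - [X - R]\<^bsup>k\<^esup>"
    by (auto simp: nsets_def)
  moreover have "[X - R]\<^bsup>k\<^esup> \<subseteq> [X]\<^bsup>k\<^esup>" by (auto simp: nsets_def)
  moreover have "finite ([X - R]\<^bsup>k\<^esup>)" using assms by (simp add: finite_imp_finite_nsets)
  moreover have "card (X - R) = card X - card R"
    using assms by (simp add: card_Diff_subset finite_subset)
  ultimately show ?thesis using assms by (simp add: card_Diff_subset)
qed

text \<open>The centres \<open>x i\<close> may coincide. Some \<open>y \<in> R\<close> is found for
  which adding \<open>y\<close> to the counted sets \<open>T\<close> gives sets of the star of
  \<open>R\<close> that can lie in the union only as exceptional members. There are more than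
  \<open>2 * card R * m\<close> of them, but at most \<open>card R * m\<close> exceptional sets,
  \<open>m\<close> being the largest number in one family; so the union would be smaller than the
  star.\<close>

lemma near_star_imp_star:
  assumes X: "finite X" and k: "1 \<le> k" and I: "finite I" "card I = card R"
    and R: "R \<subseteq> X" and x: "\<And>i. i \<in> I \<Longrightarrow> x i \<in> R"
    and G: "\<And>i. i \<in> I \<Longrightarrow> G i \<subseteq> [X]\<^bsup>k\<^esup>" "\<And>i. i \<in> I \<Longrightarrow> intersecting (G i)"
    and large: "card {S \<in> [X]\<^bsup>k\<^esup>. S \<inter> R \<noteq> {}} \<le> card (\<Union>i\<in>I. G i)"
    and expand: "\<And>i. i \<in> I \<Longrightarrow> {S \<in> G i. x i \<notin> S} \<noteq> {} \<Longrightarrow>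
        2 * card R * card {S \<in> G i. x i \<notin> S}
          < card {T \<in> [X - R]\<^bsup>(k - 1)\<^esup>. \<exists>A\<in>G i. x i \<notin> A \<and> T \<inter> A = {}}"
  shows "(\<Union>i\<in>I. G i) = {S \<in> [X]\<^bsup>k\<^esup>. S \<inter> R \<noteq> {}}"
proof -
  let ?F = "\<Union>i\<in>I. G i"
  let ?St = "{S \<in> [X]\<^bsup>k\<^esup>. S \<inter> R \<noteq> {}}"
  let ?N = "\<lambda>i. {S \<in> G i. x i \<notin> S}"
  have finSt: "finite ?St" using X by (simp add: finite_imp_finite_nsets)
  have finG: "finite (G i)" if "i \<in> I" for i
    using G(1)[OF that] X finite_imp_finite_nsets finite_subset by blast
  have F_St: "?F - ?St \<subseteq> (\<Union>i\<in>I. ?N i)"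
    using G(1) x by blast
  show ?thesis
  proof (cases "\<forall>i\<in>I. ?N i = {}")
    case True
    then have "(\<Union>i\<in>I. ?N i) = {}" by (simp only: UNION_empty_conv(2) simp_thms) 
    then have "?F \<subseteq> ?St" using F_St by (metis Diff_eq_empty_iff subset_empty)
    then show ?thesis using large finSt by (meson card_seteq)
  next
    case False
    then obtain i0 where "i0 \<in> I" by blast
    then have "Max ((\<lambda>i. card (?N i)) ` I) \<in> (\<lambda>i. card (?N i)) ` I" using I by (intro Max_in) auto
    then obtain i where i: "i \<in> I" "card (?N i) = Max ((\<lambda>i. card (?N i)) ` I)" by auto
    have max: "card (?N j) \<le> card (?N i)" if "j \<in> I" for j
      unfolding i(2) using I that by (intro Max_ge) auto
    define m where "m = card (?N i)"
    have "?N i \<noteq> {}"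
    proof
      assume e: "?N i = {}"
      have "?N j = {}" if "j \<in> I" for j
        using max[OF that] finG[OF that] unfolding e by (simp only: card.empty le_zero_eq card_eq_0_iff finite_Collect_conjI) auto
      then show False using False by blast
    qed
    note ex = expand[OF i(1) this]
    define \<T> where "\<T> = {T \<in> [X - R]\<^bsup>(k - 1)\<^esup>. \<exists>A\<in>G i. x i \<notin> A \<and> T \<inter> A = {}}"
    have big: "2 * card R * m < card \<T>" using ex unfolding m_def \<T>_def .
    have cardN: "card (\<Union>j\<in>I. ?N j) \<le> card R * m"
    proof -
      have "card (\<Union>j\<in>I. ?N j) \<le> (\<Sum>j\<in>I. card (?N j))" by (rule card_UN_le[OF I(1)])
      also have "\<dots> \<le> (\<Sum>j\<in>I. m)" unfolding m_def by (intro sum_mono max)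
      finally show ?thesis using I by simp
    qed
    have "\<exists>y\<in>R. \<forall>T\<in>\<T>. insert y T \<in> ?F \<longrightarrow> insert y T \<in> (\<Union>j\<in>I. ?N j)"
    proof (cases "inj_on x I")
      \<comment> \<open>With distinct centres \<open>y = x i\<close> works:
        \<open>insert (x i) T\<close> is disjoint from a member of \<open>G i\<close>, so it can
        only lie in another \<open>G j\<close>, whose centre it misses.\<close>
      case True
      have "insert (x i) T \<in> (\<Union>j\<in>I. ?N j)" if T: "T \<in> \<T>" and F: "insert (x i) T \<in> ?F" for T
      proof -
        obtain j where j: "j \<in> I" "insert (x i) T \<in> G j" using F by blast
        obtain A where A: "A \<in> G i" "x i \<notin> A" "T \<inter> A = {}" using T by (auto simp: \<T>_def)
        then have "insert (x i) T \<inter> A = {}" by simp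
        then have "insert (x i) T \<notin> G i"
          using G(2)[OF i(1), unfolded intersecting_def, rule_format, OF _ A(1)] by metis
        then have "j \<noteq> i" using j by blast
        then have "x j \<noteq> x i" using True i j by (auto dest: inj_onD)
        moreover have "x j \<notin> T" using x[OF j(1)] T by (auto simp: \<T>_def nsets_def)
        ultimately show ?thesis using j by blast
      qed
      then show ?thesis using x[OF i(1)] by blast
    next
      \<comment> \<open>As \<open>card I = card R\<close>, coinciding centres leave some
        \<open>y \<in> R\<close> that is no centre, and \<open>insert y T\<close> then contains no
        centre at all.\<close>
      case False
      then have "card (x ` I) < card R"
        using I by (metis card_image_le eq_card_imp_inj_on le_neq_implies_less)
      moreover have "finite R" using X R finite_subset by blast
      ultimately obtain y where y: "y \<in> R" "y \<notin> x ` I"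
        using I by (metis card_mono finite_imageI linorder_not_le subsetI)
      have "insert y T \<in> (\<Union>j\<in>I. ?N j)" if T: "T \<in> \<T>" and F: "insert y T \<in> ?F" for T
      proof -
        obtain j where j: "j \<in> I" "insert y T \<in> G j" using F by blast
        have "x j \<notin> T" using x[OF j(1)] T by (auto simp: \<T>_def nsets_def)
        moreover have "x j \<noteq> y" using y j by blast
        ultimately show ?thesis using j by blast
      qed
      then show ?thesis using y by blast
    qed
    then obtain y where y: "y \<in> R" "\<And>T. T \<in> \<T> \<Longrightarrow> insert y T \<in> ?F \<Longrightarrow> insert y T \<in> (\<Union>j\<in>I. ?N j)"
      by blast
    define \<S> where "\<S> = insert y ` \<T>"
    have yT: "y \<notin> T" if "T \<in> \<T>" for T using that y by (auto simp: \<T>_def nsets_def)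
    have cS: "card \<S> = card \<T>"
      unfolding \<S>_def using yT by (intro card_image inj_onI) (metis insert_ident)
    have S_St: "\<S> \<subseteq> ?St"
    proof
      fix S assume "S \<in> \<S>"
      then obtain T where T: "T \<in> \<T>" "S = insert y T" by (auto simp: \<S>_def)
      then have "T \<subseteq> X" "finite T" "card T = k - 1" by (auto simp: \<T>_def nsets_def)
      then show "S \<in> ?St" using T yT[OF T(1)] y(1) R k by (auto simp: nsets_def)
    qed
    have finN: "finite (\<Union>j\<in>I. ?N j)" using I finG by auto
    have finF: "finite ?F" using I finG by auto
    have "\<S> \<inter> ?F \<subseteq> (\<Union>j\<in>I. ?N j)" using y(2) by (auto simp: \<S>_def)
    then have 1: "card (\<S> \<inter> ?F) \<le> card R * m"
      using card_mono[OF finN] cardN le_trans by blast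
    have "card (?F - ?St) \<le> card R * m"
      using card_mono[OF finN F_St] cardN by simp
    moreover have "card ?F \<le> card (?F - ?St) + card (?F \<inter> ?St)"
      using finF by (metis (no_types, lifting) Un_Diff_Int card_Un_le)
    moreover have "card (?F \<inter> ?St) + card (\<S> - ?F) \<le> card ?St"
    proof -
      have "card (?F \<inter> ?St) + card (\<S> - ?F) = card ((?F \<inter> ?St) \<union> (\<S> - ?F))"
        using finSt S_St by (intro card_Un_disjoint[symmetric]) (auto intro: finite_subset)
      also have "\<dots> \<le> card ?St" using S_St by (intro card_mono finSt) auto
      finally show ?thesis .
    qed
    moreover have "card \<S> \<le> card (\<S> \<inter> ?F) + card (\<S> - ?F)"
      by (metis Int_Diff_Un card_Un_le)
    \<comment> \<open>The union has at most \<open>card R * m\<close> sets outside the star and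
      lacks more than \<open>card R * m\<close> sets of the star.\<close>
    ultimately have "card ?F < card ?St" using 1 big cS by linarith
    then show ?thesis using large by simp
  qed
qed

section \<open>Expansion of the exceptional sets\<close>

text \<open>Lowering both entries by one multiplies the coefficient by the ratio of the lower to the
  upper entry, which the hypothesis keeps at least \<open>b\<close> during all \<open>u\<close>
  steps.\<close>

lemma choose_diff_both_ge:
  fixes b :: real
  assumes "0 \<le> b" "b * M \<le> real j - real u" "u \<le> j" "j \<le> M"
  shows "b ^ u * (M choose j) \<le> (M - u choose (j - u))"
  using assms(2,3)
proof (induction u)
  case (Suc u)
  define M' j' where "M' = M - Suc u" and "j' = j - Suc u"
  have e: "M - u = Suc M'" "j - u = Suc j'" using Suc.prems assms(4) by (auto simp: M'_def j'_def)
  have "b * real (Suc M') \<le> b * M" using assms(1) e by (intro mult_left_mono) auto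
  also have "\<dots> \<le> real (Suc j')" using Suc.prems e by linarith
  finally have "b * real (Suc M') * (Suc M' choose Suc j') \<le> real (Suc j') * (Suc M' choose Suc j')"
    by (intro mult_right_mono) auto
  also have "\<dots> = real (Suc M') * (M' choose j')"
    by (metis Suc_times_binomial of_nat_mult)
  finally have "real (Suc M') * (b * (Suc M' choose Suc j')) \<le> real (Suc M') * (M' choose j')"
    by (simp add: mult_ac)
  then have st: "b * (Suc M' choose Suc j') \<le> (M' choose j')"
    by (subst (asm) mult_le_cancel_left_pos) auto
  have "b ^ u * (M choose j) \<le> (Suc M' choose Suc j')"
    using Suc.IH Suc.prems by (simp add: e)
  then have "b * (b ^ u * (M choose j)) \<le> b * (Suc M' choose Suc j')"
    using assms(1) by (rule mult_left_mono)
  with st show ?case unfolding M'_def j'_def by (simp add: mult.assoc)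
qed simp

text \<open>Lowering only the upper entry \<open>m\<close> by one multiplies the coefficient by
  \<open>(m - j) / m\<close>, which stays at least \<open>b\<close>.\<close>

lemma choose_diff_top_ge:
  fixes b :: real
  assumes "0 \<le> b" "b * M \<le> real M - real w - real j" "j + w \<le> M"
  shows "b ^ w * (M choose j) \<le> (M - w choose j)"
  using assms(2,3)
proof (induction w)
  case (Suc w)
  define M' where "M' = M - Suc w"
  have e: "M - w = Suc M'" using Suc.prems by (auto simp: M'_def)
  have "b * real (Suc M') \<le> b * M" using assms(1) e by (intro mult_left_mono) auto
  also have "\<dots> \<le> real (Suc M' - j)" using Suc.prems e by linarith
  finally have "b * real (Suc M') * (Suc M' choose j) \<le> real (Suc M' - j) * (Suc M' choose j)"
    by (intro mult_right_mono) auto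
  also have "\<dots> = real (Suc M') * (M' choose j)"
    by (metis binomial_absorb_comp diff_Suc_1 of_nat_mult)
  finally have "real (Suc M') * (b * (Suc M' choose j)) \<le> real (Suc M') * (M' choose j)"
    by (simp add: mult_ac)
  then have st: "b * (Suc M' choose j) \<le> (M' choose j)"
    by (subst (asm) mult_le_cancel_left_pos) auto
  have "b ^ w * (M choose j) \<le> (Suc M' choose j)"
    using Suc.IH Suc.prems by (simp add: e)
  then have "b * (b ^ w * (M choose j)) \<le> b * (Suc M' choose j)"
    using assms(1) by (rule mult_left_mono)
  with st show ?case unfolding M'_def by (simp add: mult.assoc)
qed simp

text \<open>Lowering \<open>m\<close> by one multiplies the quotient of \<open>m choose b\<close> by
  \<open>m choose a\<close> by \<open>(m - b) / (m - a)\<close>. Because \<open>g \<ge> 1\<close>,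
  the hypothesis at \<open>M\<close> persists for smaller \<open>m\<close>, so \<open>s\<close>
  steps gain \<open>g ^ s\<close>.\<close>

lemma choose_ratio_growth:
  fixes g :: real
  assumes g: "1 \<le> g" "g * (real M - real a) \<le> real M - real b" and s: "a + s \<le> M" and ba: "b \<le> a"
  shows "g ^ s * (M choose b) * (M - s choose a) \<le> (M - s choose b) * real (M choose a)"
  using s
proof (induction s)
  case (Suc s)
  define m where "m = M - Suc s"
  have e: "M - s = Suc m" using Suc.prems by (auto simp: m_def)
  have m: "a \<le> Suc m" "b \<le> Suc m" using Suc.prems ba by (auto simp: m_def)
  have absorb: "real (Suc m) * (m choose i) = (real (Suc m) - real i) * (Suc m choose i)" if "i \<le> Suc m" for i
  proof -
    have "real (Suc m) * (m choose i) = real (Suc m - i) * (Suc m choose i)"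
      by (metis binomial_absorb_comp diff_Suc_1 of_nat_mult)
    then show ?thesis using that by (simp only: of_nat_diff)
  qed
  have gs: "g * (real (Suc m) - real a) \<le> real (Suc m) - real b"
  proof -
    have m: "real (Suc m) = real M - real s" using e Suc.prems by linarith
    have "1 * real s \<le> g * real s" using g by (intro mult_right_mono) auto
    moreover have "g * (real M - real s - real a) = g * (real M - real a) - g * real s"
      by (simp add: algebra_simps)
    ultimately show ?thesis using g unfolding m by linarith
  qed
  have IH: "g ^ s * (M choose b) * (Suc m choose a) \<le> (Suc m choose b) * real (M choose a)"
    using Suc.IH Suc.prems by (simp add: e)
  have "real (Suc m) * (g ^ Suc s * (M choose b) * (m choose a))
      = g * (real (Suc m) * (m choose a)) * (g ^ s * (M choose b))"
    by (simp add: mult_ac)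
  also have "\<dots> = (g * (real (Suc m) - real a)) * (g ^ s * (M choose b) * (Suc m choose a))"
    unfolding absorb[OF m(1)] by (simp only: mult_ac)
  also have "\<dots> \<le> (real (Suc m) - real b) * ((Suc m choose b) * real (M choose a))"
    using g m by (intro mult_mono[OF gs IH]) auto
  also have "\<dots> = real (Suc m) * ((m choose b) * real (M choose a))"
    using absorb[OF m(2)] by (simp only: mult.assoc[symmetric])
  finally have "g ^ Suc s * (M choose b) * (m choose a) \<le> (m choose b) * real (M choose a)"
    by (subst (asm) mult_le_cancel_left_pos) auto
  then show ?case by (simp add: m_def)
qed simp

text \<open>Here \<open>q\<close> is the size of a trace on \<open>R\<close>, and \<open>a\<close>
  the size of the complement in \<open>X - R\<close> of a \<open>k\<close>-set with that trace. The
  first bound shows that the exceptional sets are few enough to be compared with all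
  \<open>a\<close>-subsets of \<open>n - r - s\<close> points; the second is the expansion from
  level \<open>a\<close> to level \<open>k - 1\<close> on that many points.\<close>

lemma choose_expansion_bounds:
  fixes n k r s q a :: nat
  assumes q: "q < r" and sr: "2 * (s + r) \<le> k" and n: "2 * k + 2 * r \<le> n" and a: "a = n - r - (k - q)"
  shows "(k / (2 * real n)) ^ (s + r) * (n - 1 choose k) \<le> (n - r - s choose a)"
    and "real (r * 2 ^ (r + 1)) < (1 + (real n - 2 * real k) / (2 * real k)) ^ s * (real k / real n) \<Longrightarrow>
      real (r * 2 ^ (r + 1)) * (n - r - s choose a) < (n - r - s choose (k - 1))"
proof -
  define \<beta> where "\<beta> = k / (2 * real n)"
  have kn: "0 < k" "0 < n" using q sr n by auto
  have b: "0 \<le> \<beta>" "\<beta> \<le> 1" using n kn by (auto simp: \<beta>_def divide_le_eq)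
  have bn: "\<beta> * n = k / 2" using kn by (simp add: \<beta>_def)
  have bM: "\<beta> * M \<le> k / 2" if "M \<le> n" for M
    unfolding bn[symmetric] using b that by (intro mult_left_mono) auto
  have sym: "n - r - s choose a = (n - r - s choose (k - q - s))"
    using q sr n by (subst binomial_symmetric) (auto simp: a)
  \<comment> \<open>Passing from \<open>n - 1 choose k\<close> to
    \<open>n - r - s choose (k - q - s)\<close> takes \<open>w\<close> steps that lower the upper
    entry alone and \<open>u\<close> steps that lower both: \<open>s + r - 1\<close> steps, each
    keeping at least a fraction \<open>k / (2 * real n)\<close>.\<close>
  define w u where "w = r - 1 - q" and "u = s + q"
  have 1: "\<beta> ^ w * (n - 1 choose k) \<le> (n - 1 - w choose k)"
  proof (rule choose_diff_top_ge[OF b(1)])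
    have "k / 2 \<le> real (n - 1) - real w - real k" using q n kn by (auto simp: w_def)
    then show "\<beta> * real (n - 1) \<le> real (n - 1) - real w - real k" using bM[of "n - 1"] by simp
    show "k + w \<le> n - 1" using q n kn by (auto simp: w_def)
  qed
  have 2: "\<beta> ^ u * (n - 1 - w choose k) \<le> (n - 1 - w - u choose (k - u))"
  proof (rule choose_diff_both_ge[OF b(1)])
    have "2 * real u \<le> k" using q sr by (auto simp: u_def)
    then show "\<beta> * real (n - 1 - w) \<le> real k - real u" using bM[of "n - 1 - w"] by simp
    show "u \<le> k" "k \<le> n - 1 - w" using q sr n by (auto simp: u_def w_def)
  qed
  have "\<beta> ^ (s + r) \<le> \<beta> ^ (u + w)"
    using b q by (intro power_decreasing) (auto simp: u_def w_def)
  then have "\<beta> ^ (s + r) * (n - 1 choose k) \<le> \<beta> ^ (u + w) * (n - 1 choose k)"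
    by (intro mult_right_mono) auto
  also have "\<dots> \<le> \<beta> ^ u * (n - 1 - w choose k)"
    using mult_left_mono[OF 1, of "\<beta> ^ u"] b by (simp add: power_add mult_ac)
  also note 2
  also have "(n - 1 - w - u choose (k - u)) = (n - r - s choose a)"
    unfolding sym using q by (simp add: w_def u_def add.commute)
  finally show "(k / (2 * real n)) ^ (s + r) * (n - 1 choose k) \<le> (n - r - s choose a)"
    by (simp add: \<beta>_def)

  \<comment> \<open>This is \<open>n / (2 * k)\<close>, so that \<open>g * k\<close> is
    \<open>n / 2\<close>, which lies below \<open>(n - r) - (k - 1)\<close>.\<close>
  define g where "g = 1 + (real n - 2 * real k) / (2 * real k)"
  assume "real (r * 2 ^ (r + 1)) < (1 + (real n - 2 * real k) / (2 * real k)) ^ s * (real k / real n)"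
  then have L: "real (r * 2 ^ (r + 1)) < g ^ s * (real k / real n)" by (simp add: g_def)
  let ?P = "real (n - r - s choose a)"
  have g1: "1 \<le> g" using n by (simp add: g_def)
  have ka: "k - 1 \<le> a" "a + s \<le> n - r" "a \<le> n - r" using q sr n by (auto simp: a)
  have "g * (real (n - r) - real a) = g * real (k - q)" using q sr n by (auto simp: a)
  also have "\<dots> \<le> g * k" using g1 by (intro mult_left_mono) auto
  also have "\<dots> = n / 2" using kn by (simp add: g_def field_simps)
  also have "\<dots> \<le> real (n - r) - real (k - 1)" using n kn by auto
  finally have 3: "g ^ s * (n - r choose (k - 1)) * ?P \<le> (n - r - s choose (k - 1)) * real (n - r choose a)"
    using g1 ka by (intro choose_ratio_growth) auto
  \<comment> \<open>Before points are removed, passing from level \<open>a\<close> to level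
    \<open>k - 1\<close> loses at most a factor \<open>k / n\<close>; a loss can occur only for an
    empty trace, when \<open>k - q\<close> exceeds \<open>k - 1\<close>.\<close>
  have 4: "k / n * (n - r choose a) \<le> (n - r choose (k - 1))"
  proof -
    have "n - r choose a = (n - r choose (k - q))"
      using q sr n by (subst binomial_symmetric) (auto simp: a)
    moreover have "k / n * (n - r choose (k - q)) \<le> (n - r choose (k - 1))"
    proof (cases "q = 0")
      case True
      have "k * (n - r choose k) = (n - r - (k - 1)) * (n - r choose (k - 1))"
        using choose_Suc_mult[of "k - 1" "n - r"] kn by simp
      also have "\<dots> \<le> n * (n - r choose (k - 1))" by (intro mult_right_mono) auto
      finally have "real k * (n - r choose k) \<le> n * (n - r choose (k - 1))"
        by (metis of_nat_le_iff of_nat_mult)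
      then show ?thesis using True kn by (simp add: field_simps)
    next
      case False
      have "n - r choose (k - q) \<le> (n - r choose (k - 1))"
        using False n by (intro binomial_mono) auto
      moreover have "k / n \<le> 1" using n kn by simp
      ultimately have "k / n * (n - r choose (k - q)) \<le> 1 * real (n - r choose (k - 1))"
        by (intro mult_mono) auto
      then show ?thesis by simp
    qed
    ultimately show ?thesis by simp
  qed
  have Q: "0 < real (n - r choose a)" using ka by simp
  have P: "0 < ?P"
  proof -
    have "a \<le> n - r - s" using ka by simp
    then show ?thesis by simp
  qed
  have "real (r * 2 ^ (r + 1)) * ?P * (n - r choose a) < g ^ s * (real k / real n) * ?P * (n - r choose a)"
    using L P Q by (intro mult_strict_right_mono) auto
  also have "\<dots> = g ^ s * ?P * (k / n * (n - r choose a))" by (simp add: mult_ac)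
  also have "\<dots> \<le> g ^ s * ?P * (n - r choose (k - 1))"
    using g1 4 by (intro mult_left_mono) auto
  also have "\<dots> \<le> (n - r - s choose (k - 1)) * real (n - r choose a)"
    using 3 by (simp add: mult_ac)
  finally show "real (r * 2 ^ (r + 1)) * (n - r - s choose a) < (n - r - s choose (k - 1))"
    using Q by (simp add: mult_less_cancel_right_pos)
qed

text \<open>
  The members of \<open>N\<close> with the most popular trace on \<open>R\<close> are replaced by their complements in \<open>X - R\<close>;
  the sets to be counted are then their shadow, which is compared with that of \<open>n - r - s\<close> points.
\<close>
lemma disjoint_expansion:
  assumes X: "finite X" "card X = n" and R: "R \<subseteq> X" "card R = r" and x: "x \<in> R"
    and N: "N \<subseteq> [X - {x}]\<^bsup>k\<^esup>" "N \<noteq> {}"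
    and sr: "2 * (s + r) \<le> k" and n: "2 * k + 2 * r \<le> n"
    and small: "card N \<le> (k / (2 * real n)) ^ (s + r) * (n - 1 choose k)"
    and growth: "real (r * 2 ^ (r + 1)) < (1 + (real n - 2 * real k) / (2 * real k)) ^ s * (real k / real n)"
  shows "2 * r * card N < card {T \<in> [X - R]\<^bsup>(k - 1)\<^esup>. \<exists>A\<in>N. T \<inter> A = {}}"
proof -
  let ?NQ = "\<lambda>Q. {A \<in> N. A \<inter> R = Q}"
  let ?T = "{T \<in> [X - R]\<^bsup>(k - 1)\<^esup>. \<exists>A\<in>N. T \<inter> A = {}}"
  have finR: "finite R" using X R finite_subset by blast
  have finN: "finite N" using N X by (meson finite_Diff finite_imp_finite_nsets finite_subset)
  \<comment> \<open>Pigeonhole over the \<open>2 ^ r\<close> possible traces on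
    \<open>R\<close>.\<close>
  have "\<exists>Q\<in>Pow R. card N \<le> 2 ^ r * card (?NQ Q)"
  proof (rule ccontr)
    assume c: "\<not> ?thesis"
    have "2 ^ r * card N = 2 ^ r * (\<Sum>Q\<in>Pow R. card (?NQ Q))"
    proof -
      have "(\<lambda>A. A \<inter> R) ` N \<subseteq> Pow R" by blast
      from sum.group[OF finN _ this, of "\<lambda>_. 1::nat"] show ?thesis using finR by simp
    qed
    also have "\<dots> = (\<Sum>Q\<in>Pow R. 2 ^ r * card (?NQ Q))" by (rule sum_distrib_left)
    also have "\<dots> < (\<Sum>Q\<in>Pow R. card N)"
      using c finR by (intro sum_strict_mono) (auto simp: not_le)
    also have "\<dots> = 2 ^ r * card N" using finR R by (simp add: card_Pow)
    finally show False by simp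
  qed
  then obtain Q where Q: "Q \<subseteq> R" "card N \<le> 2 ^ r * card (?NQ Q)" by blast
  have "card N > 0" using N finN by (simp add: card_gt_0_iff)
  then have "card (?NQ Q) > 0" using Q(2) by (metis mult_0_right not_gr0 not_le)
  then obtain A0 where A0: "A0 \<in> N" "A0 \<inter> R = Q" by (metis (mono_tags, lifting) card_gt_0_iff empty_Collect_eq)
  \<comment> \<open>The members of \<open>N\<close> miss \<open>x\<close>, so the trace is a proper
    subset of \<open>R\<close>; this is the condition \<open>q < r\<close> of
    \<open>choose_expansion_bounds\<close>.\<close>
  have "x \<notin> Q" using A0 N by (auto simp: nsets_def)
  then have "Q \<subset> R" using Q x by blast
  then have q: "card Q < r" using finR R psubset_card_mono by blast
  define a where "a = n - r - (k - card Q)"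
  let ?Y = "X - R"
  have Y: "finite ?Y" "card ?Y = n - r" using X R finR by (auto simp: card_Diff_subset)
  define \<A> where "\<A> = (\<lambda>A. ?Y - A) ` ?NQ Q"
  have AX: "A \<subseteq> X" "card A = k" "finite A" if "A \<in> N" for A using that N by (auto simp: nsets_def)
  have "inj_on (\<lambda>A. ?Y - A) (?NQ Q)"
  proof (rule inj_onI)
    fix A B assume AB: "A \<in> ?NQ Q" "B \<in> ?NQ Q" "?Y - A = ?Y - B"
    have "A = Q \<union> (?Y - (?Y - A))" "B = Q \<union> (?Y - (?Y - B))"
      using AB(1,2) AX by blast+
    then show "A = B" using AB(3) by metis
  qed
  then have cA: "card \<A> = card (?NQ Q)" unfolding \<A>_def by (rule card_image)
  have AY: "\<A> \<subseteq> [?Y]\<^bsup>a\<^esup>"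
  proof
    fix B assume "B \<in> \<A>"
    then obtain A where A: "A \<in> N" "A \<inter> R = Q" "B = ?Y - A" by (auto simp: \<A>_def)
    have "card (A - R) = k - card Q"
      using A AX[OF A(1)] finR by (metis card_Diff_subset_Int finite_Int)
    moreover have "B = ?Y - (A - R)" using A by blast
    moreover have "A - R \<subseteq> ?Y" using AX[OF A(1)] by blast
    ultimately have "card B = a"
      using Y AX[OF A(1)] by (simp add: card_Diff_subset a_def)
    then show "B \<in> [?Y]\<^bsup>a\<^esup>" using A Y by (auto simp: nsets_def)
  qed
  note bounds = choose_expansion_bounds[OF q sr n a_def]
  have "card (?NQ Q) \<le> card N" using finN by (intro card_mono) auto
  then have "real (card \<A>) \<le> real (n - r - s choose a)"
    using small bounds(1) cA by linarith
  then have "card \<A> \<le> n - r - s choose a" by simp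
  then have "card \<A> * (n - r - s choose (k - 1))
      \<le> card {T. card T = k - 1 \<and> (\<exists>A\<in>\<A>. T \<subseteq> A)} * (n - r - s choose a)"
    using sr q n by (intro card_shadow_ge[OF Y(1) AY]) (auto simp: a_def)
  also have "\<dots> \<le> card ?T * (n - r - s choose a)"
  proof (intro mult_right_mono card_mono)
    show "finite ?T" using Y by (simp add: finite_imp_finite_nsets)
    show "{T. card T = k - 1 \<and> (\<exists>A\<in>\<A>. T \<subseteq> A)} \<subseteq> ?T"
      using Y(1) by (auto simp: \<A>_def nsets_def intro: finite_subset)
  qed auto
  finally have up: "real (card \<A>) * (n - r - s choose (k - 1)) \<le> real (card ?T) * (n - r - s choose a)"
    by (simp only: of_nat_mult[symmetric] of_nat_le_iff)
  let ?P = "real (n - r - s choose a)"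
  \<comment> \<open>The constant \<open>r * 2 ^ (r + 1)\<close> in \<open>growth\<close> is the
    desired factor \<open>2 * r\<close> times the \<open>2 ^ r\<close> lost to the
    pigeonhole.\<close>
  have "2 * r * card N \<le> 2 * r * (2 ^ r * card \<A>)" using Q(2) cA by (intro mult_left_mono) auto
  then have "real (2 * r * card N) \<le> real (2 * r * (2 ^ r * card \<A>))" by (rule of_nat_mono)
  then have "real (2 * r * card N) * ?P \<le> real (2 * r * (2 ^ r * card \<A>)) * ?P"
    by (rule mult_right_mono) simp
  also have "\<dots> = real (card \<A>) * (real (r * 2 ^ (r + 1)) * ?P)" by simp
  also have "\<dots> < real (card \<A>) * (n - r - s choose (k - 1))"
    using bounds(2)[OF growth] \<open>card (?NQ Q) > 0\<close> cA by (intro mult_strict_left_mono) auto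
  also note up
  finally have "real (2 * r * card N) < real (card ?T)"
    by (rule mult_right_less_imp_less) simp
  then show ?thesis by (simp only: of_nat_less_iff)
qed

text \<open>The exponential bounds the tail below \<open>k\<close> when the bias is halfway between
  \<open>k / n\<close> and \<open>1 / 2\<close>, so that the mean exceeds \<open>k\<close> by
  \<open>(n - 2 * k) / 4\<close>. The prefactor absorbs the smallness condition and the coefficient
  in \<open>near_extremal_imp_near_star\<close>, using
  \<open>c - 1 \<ge> 1 / (2 * n)\<close>.\<close>

definition error_bound :: "nat \<Rightarrow> nat \<Rightarrow> nat \<Rightarrow> real" where
  "error_bound r n k = 400 * 2 ^ r * real n ^ 2 * exp (- ((real n - 2 * real k)\<^sup>2 / (16 * real n)))"

text \<open>The hypothesis \<open>cases\<close> offers two ways of excluding exceptional sets: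
  either the bound on their number is below \<open>1\<close>, or they are few enough for
  \<open>disjoint_expansion\<close> to contradict extremality.\<close>

lemma extremal_imp_star:
  assumes X: "finite X" "card X = n" and k: "1 \<le> k" and n: "2 * k + 2 * r \<le> n" and r: "1 \<le> r"
    and I: "finite I" "card I = r"
    and G: "\<And>i. i \<in> I \<Longrightarrow> G i \<subseteq> [X]\<^bsup>k\<^esup>" "\<And>i. i \<in> I \<Longrightarrow> intersecting (G i)"
    and large: "(n choose k) - (n - r choose k) \<le> card (\<Union>i\<in>I. G i)"
    and err: "error_bound r n k < 1"
    and cases: "error_bound r n k * (n - 1 choose k) < 1 \<or>
      2 * (s + r) \<le> k \<and> error_bound r n k \<le> (k / (2 * real n)) ^ (s + r) \<and>
      real (r * 2 ^ (r + 1)) < (1 + (real n - 2 * real k) / (2 * real k)) ^ s * (real k / real n)"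
  shows "\<exists>R\<in>[X]\<^bsup>r\<^esup>. (\<Union>i\<in>I. G i) = {S \<in> [X]\<^bsup>k\<^esup>. S \<inter> R \<noteq> {}}"
proof -
  define t where "t = real n - 2 * real k"
  have t: "1 \<le> t" using n r by (simp add: t_def)
  have n0: "0 < n" using n k by simp
  define p where "p = (k / n + 1/2) / 2"
  define c where "c = - log 2 p"
  have kn: "0 < k / n" "k / n \<le> 1/2" using n k by (auto simp: field_simps)
  have p: "1/4 < p" "p \<le> 1/2" using kn by (auto simp: p_def)
  have pc: "2 powr (-c) = p" using p by (simp add: c_def)
  have p2: "2 * p = 1 - t / (2 * real n)" using n0 by (simp add: p_def t_def field_simps)
  \<comment> \<open>As \<open>2 * p = 1 - t / (2 * n)\<close> and
    \<open>c - 1 = - log 2 (2 * p)\<close>, this is \<open>ln y \<le> y - 1\<close> together with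
    \<open>ln 2 \<le> 1\<close>.\<close>
  have c1: "t / (2 * real n) \<le> c - 1"
  proof -
    have "ln (2 * p) \<le> 2 * p - 1" using p by (intro ln_le_minus_one) auto
    then have "t / (2 * real n) \<le> - ln (2 * p)" by (simp add: p2)
    also have "\<dots> \<le> - ln (2 * p) / ln 2"
    proof -
      have "0 \<le> - ln (2 * p)" using p by simp
      moreover have "ln 2 \<le> (1::real)" using ln_le_minus_one[of 2] by simp
      ultimately show ?thesis using mult_left_mono[of "ln 2" 1 "- ln (2 * p)"]
        by (subst pos_le_divide_eq) auto
    qed
    also have "\<dots> = c - 1" using p by (simp add: c_def log_def ln_mult field_simps)
    finally show ?thesis .
  qed
  have tn: "1 / (2 * real n) \<le> t / (2 * real n)" using t by (intro divide_right_mono) auto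
  have c: "1 < c" "c \<le> 2"
  proof -
    show "1 < c" using c1 t n0 by (smt (verit) divide_pos_pos of_nat_0_less_iff)
    have "log 2 (1/4) \<le> log 2 p" using p by simp
    moreover have "log 2 (1/4::real) = -2"
      using log_powr_cancel[of 2 "-2"] by (simp add: powr_minus)
    ultimately show "c \<le> 2" by (simp add: c_def)
  qed
  define T where "T = bmeas (2 powr (-c)) X {S. card S < k}"
  define E where "E = exp (- (t\<^sup>2 / (16 * real n)))"
  define \<rho> where "\<rho> = error_bound r n k"
  have rho: "\<rho> = 400 * 2 ^ r * n ^ 2 * E" by (simp add: \<rho>_def error_bound_def E_def t_def)
  have T0: "0 \<le> T" unfolding T_def pc using p by (intro bmeas_nonneg) auto
  have TE: "T \<le> E"
  proof -
    have "real k + t / 4 \<le> card X * p" using n0 X by (simp add: p_def t_def field_simps)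
    then have "T \<le> exp (- ((t / 4)\<^sup>2 / card X))"
      unfolding T_def pc using p X n0 t by (intro bmeas_tail_le) auto
    then show ?thesis by (simp add: E_def X power_divide mult.commute)
  qed
  have n1: "1 \<le> real n" using n0 by simp
  have c1': "1 / (2 * real n) \<le> c - 1" using c1 tn by linarith
  have "192 * n * (2 ^ r * T) * (2 * n) \<le> 192 * n * (2 ^ r * E) * (2 * n)"
    using TE by (intro mult_left_mono mult_right_mono) auto
  also have "\<dots> = 384 * 2 ^ r * n ^ 2 * E" by (simp add: power2_eq_square)
  also have "\<dots> \<le> \<rho>" unfolding rho by (intro mult_right_mono) (auto simp: E_def)
  also have "\<dots> < 1" using err by (simp add: \<rho>_def)
  finally have "192 * n * (2 ^ r * T) < 1 / (2 * real n)" using n0 by (simp add: less_divide_eq)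
  then have small: "192 * real (card X) * (2 ^ r * T) < c - 1" using c1' by (simp add: X)
  have coef: "48 * (2 ^ r * T) / (c - 1) + 2 * T \<le> \<rho>"
  proof -
    have "48 * (2 ^ r * T) / (c - 1) \<le> 48 * (2 ^ r * T) / (1 / (2 * real n))"
      using c1' T0 c n0 by (intro divide_left_mono) auto
    also have "\<dots> = 96 * n * 2 ^ r * T" by simp
    also have "\<dots> \<le> 96 * n\<^sup>2 * 2 ^ r * T"
      using T0 n1 by (intro mult_right_mono mult_left_mono) (auto simp: power2_eq_square)
    finally have 1: "48 * (2 ^ r * T) / (c - 1) \<le> 96 * n\<^sup>2 * 2 ^ r * T" .
    have "1 * 1 \<le> real n ^ 2 * (2::real) ^ r" using n1 by (intro mult_mono) (auto simp: one_le_power)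
    then have "2 * T \<le> 2 * (n\<^sup>2 * 2 ^ r) * T" using T0 by (intro mult_right_mono) auto
    with 1 have "48 * (2 ^ r * T) / (c - 1) + 2 * T \<le> 98 * (n\<^sup>2 * 2 ^ r * T)" by (simp add: mult_ac)
    also have "\<dots> \<le> 400 * (n\<^sup>2 * 2 ^ r * E)" using T0 TE by (intro mult_mono) auto
    finally show ?thesis by (simp add: rho mult_ac)
  qed
  have Xne: "X \<noteq> {}" using X n0 by auto
  have "\<exists>x\<in>X. card {S \<in> G i. x \<notin> S} \<le> \<rho> * (n - 1 choose k)" if i: "i \<in> I" for i
  proof -
    have "(card X choose k) \<le> card (\<Union>i\<in>I. G i) + (card X - r choose k)" using large X by simp
    then obtain x where x: "x \<in> X"
        "card {S \<in> G i. x \<notin> S} \<le> (48 * (2 ^ r * T) / (c - 1) + 2 * T) * (card X - 1 choose k)"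
      using near_extremal_imp_near_star[where G = G and i = i, OF c X(1) Xne k I _ G _ T_def small i] n X by auto
    have "(48 * (2 ^ r * T) / (c - 1) + 2 * T) * (card X - 1 choose k) \<le> \<rho> * (n - 1 choose k)"
      unfolding X using coef by (intro mult_right_mono) auto
    then show ?thesis using x order_trans by blast
  qed
  then obtain x where x: "\<And>i. i \<in> I \<Longrightarrow> x i \<in> X"
      "\<And>i. i \<in> I \<Longrightarrow> card {S \<in> G i. x i \<notin> S} \<le> \<rho> * (n - 1 choose k)"
    by metis
  have "card (x ` I) \<le> r" using card_image_le[OF I(1), of x] I by simp
  moreover have "r \<le> card X" using X n by simp
  \<comment> \<open>The centres may be fewer than \<open>r\<close> points, so they are extended
    arbitrarily to an \<open>r\<close>-set.\<close>
  ultimately obtain R where R: "x ` I \<subseteq> R" "R \<subseteq> X" "card R = r"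
    using exists_subset_between[of "x ` I" r X] x X by (metis image_subsetI)
  have "(\<Union>i\<in>I. G i) = {S \<in> [X]\<^bsup>k\<^esup>. S \<inter> R \<noteq> {}}"
  proof (rule near_star_imp_star[where x = x])
    show "card {S \<in> [X]\<^bsup>k\<^esup>. S \<inter> R \<noteq> {}} \<le> card (\<Union>i\<in>I. G i)"
      using large card_star[OF X(1) R(2), of k] X R by simp
  next
    fix i assume i: "i \<in> I" and ne: "{S \<in> G i. x i \<notin> S} \<noteq> {}"
    let ?N = "{S \<in> G i. x i \<notin> S}"
    have "finite ?N" using G(1)[OF i] X by (simp add: finite_subset finite_imp_finite_nsets)
    then have "1 \<le> card ?N" using ne by (simp add: Suc_leI card_gt_0_iff)
    then have "1 \<le> real (card ?N)" by simp
    with x(2)[OF i] have "\<not> \<rho> * (n - 1 choose k) < 1" by linarith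
    with cases have good: "2 * (s + r) \<le> k" "\<rho> \<le> (k / (2 * real n)) ^ (s + r)"
      "real (r * 2 ^ (r + 1)) < (1 + (real n - 2 * real k) / (2 * real k)) ^ s * (real k / real n)"
      by (auto simp: \<rho>_def)
    have "2 * r * card ?N < card {T \<in> [X - R]\<^bsup>(k - 1)\<^esup>. \<exists>A\<in>?N. T \<inter> A = {}}"
    proof (rule disjoint_expansion[OF X R(2,3) _ _ ne good(1) n _ good(3)])
      show "x i \<in> R" using R i by blast
      show "?N \<subseteq> [X - {x i}]\<^bsup>k\<^esup>" using G(1)[OF i] by (auto simp: nsets_def)
      have "\<rho> * (n - 1 choose k) \<le> (k / (2 * real n)) ^ (s + r) * (n - 1 choose k)"
        using good(2) by (intro mult_right_mono) auto
      with x(2)[OF i] show "card ?N \<le> (k / (2 * real n)) ^ (s + r) * (n - 1 choose k)" by linarith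
    qed
    moreover have "{T \<in> [X - R]\<^bsup>(k - 1)\<^esup>. \<exists>A\<in>?N. T \<inter> A = {}}
        = {T \<in> [X - R]\<^bsup>(k - 1)\<^esup>. \<exists>A\<in>G i. x i \<notin> A \<and> T \<inter> A = {}}" by blast
    ultimately show "2 * card R * card ?N
        < card {T \<in> [X - R]\<^bsup>(k - 1)\<^esup>. \<exists>A\<in>G i. x i \<notin> A \<and> T \<inter> A = {}}"
      using R by simp
  qed (use X k I R G in auto)
  moreover have "R \<in> [X]\<^bsup>r\<^esup>" using R X by (auto simp: nsets_def intro: finite_subset)
  ultimately show ?thesis by blast
qed

section \<open>Choice of parameters\<close>

lemma polynomial_error_eventually_small:
  fixes A :: real
  shows "\<exists>n0. \<forall>n\<ge>n0. A * real n ^ 2 * (2 * real n) ^ m * exp (- (real n / 64)) < 1"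
proof -
  have "((\<lambda>x::real. x ^ (m + 2) / exp x) \<longlongrightarrow> 0) at_top" by (rule tendsto_power_div_exp_0)
  moreover have "filterlim (\<lambda>n::nat. real n / 64) at_top sequentially"
    using filterlim_at_top_mult_tendsto_pos[OF tendsto_const _ filterlim_real_sequentially, of "1/64"] by simp
  ultimately have "((\<lambda>n. (real n / 64) ^ (m + 2) / exp (real n / 64)) \<longlongrightarrow> 0) sequentially"
    by (rule filterlim_compose)
  then have "((\<lambda>n. A * 2 ^ m * 64 ^ (m + 2) * ((real n / 64) ^ (m + 2) / exp (real n / 64))) \<longlongrightarrow> 0) sequentially"
    by (rule tendsto_mult_right_zero)
  moreover have "A * 2 ^ m * 64 ^ (m + 2) * ((real n / 64) ^ (m + 2) / exp (real n / 64))
      = A * real n ^ 2 * (2 * real n) ^ m * exp (- (real n / 64))" for n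
    by (simp add: power_add power_mult_distrib power_divide exp_minus field_simps power2_eq_square)
  ultimately have "((\<lambda>n. A * real n ^ 2 * (2 * real n) ^ m * exp (- (real n / 64))) \<longlongrightarrow> 0) sequentially"
    by (simp only:)
  then have "eventually (\<lambda>n. A * real n ^ 2 * (2 * real n) ^ m * exp (- (real n / 64)) < 1) sequentially"
    by (rule order_tendstoD) simp
  then show ?thesis unfolding eventually_sequentially .
qed

lemma growth_target: "real (r * 2 ^ (r + 1)) < 2 ^ (2 * r + 1)"
proof -
  have "r * 2 ^ (r + 1) < 2 ^ r * 2 ^ (r + 1)" by (intro mult_strict_right_mono) auto
  also have "\<dots> = (2::nat) ^ (2 * r + 1)" by (subst power_add[symmetric]) (simp add: mult_2)
  finally have "real (r * 2 ^ (r + 1)) < real (2 ^ (2 * r + 1))" by (simp only: of_nat_less_iff)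
  then show ?thesis by simp
qed

text \<open>Here \<open>n - 2 * k \<ge> n / 2\<close>, so the error is exponentially small in
  \<open>n\<close> and beats any fixed power of \<open>n\<close>. If \<open>k\<close> is below
  \<open>2 * (s + r) = 6 * r + 8\<close>, the binomial coefficient is polynomially bounded;
  otherwise \<open>(k / (2 * n)) ^ (s + r)\<close> is only polynomially small.\<close>

lemma parameters_sparse:
  fixes n k r :: nat
  assumes nk: "4 * k < n" and k: "1 \<le> k"
    and small: "400 * 2 ^ r * real n ^ 2 * (2 * real n) ^ (6 * r + 8) * exp (- (real n / 64)) < 1"
  defines "s \<equiv> 2 * r + 4"
  shows "error_bound r n k < 1"
    and "error_bound r n k * (n - 1 choose k) < 1 \<or>
      2 * (s + r) \<le> k \<and> error_bound r n k \<le> (k / (2 * real n)) ^ (s + r) \<and>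
      real (r * 2 ^ (r + 1)) < (1 + (real n - 2 * real k) / (2 * real k)) ^ s * (real k / real n)"
proof -
  let ?\<rho> = "error_bound r n k"
  define t where "t = real n - 2 * real k"
  have n1: "1 \<le> real n" using nk by simp
  have t: "n / 2 \<le> t" using nk by (simp add: t_def)
  have "(n / 2)\<^sup>2 \<le> t\<^sup>2" using t by (intro power_mono) auto
  then have "n / 64 \<le> t\<^sup>2 / (16 * real n)" using n1 by (simp add: field_simps power2_eq_square)
  then have "?\<rho> \<le> 400 * 2 ^ r * real n ^ 2 * exp (- (real n / 64))"
    unfolding error_bound_def t_def[symmetric] by (intro mult_left_mono) auto
  then have "?\<rho> * (2 * real n) ^ (6 * r + 8) \<le> 400 * 2 ^ r * real n ^ 2 * exp (- (real n / 64)) * (2 * real n) ^ (6 * r + 8)"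
    by (intro mult_right_mono) auto
  also have "\<dots> < 1" using small by (simp add: mult_ac)
  finally have rho: "?\<rho> * (2 * real n) ^ (6 * r + 8) < 1" .
  have rho0: "0 \<le> ?\<rho>" by (simp add: error_bound_def)
  have lt: "?\<rho> * y < 1" if "y \<le> (2 * real n) ^ (6 * r + 8)" for y
    using mult_left_mono[OF that rho0] rho by linarith
  have "1 \<le> (2 * real n) ^ (6 * r + 8)" using n1 by (intro one_le_power) auto
  from lt[OF this] show "?\<rho> < 1" by simp
  show "?\<rho> * (n - 1 choose k) < 1 \<or>
      2 * (s + r) \<le> k \<and> ?\<rho> \<le> (k / (2 * real n)) ^ (s + r) \<and>
      real (r * 2 ^ (r + 1)) < (1 + (real n - 2 * real k) / (2 * real k)) ^ s * (real k / real n)"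
  proof (cases "2 * (s + r) \<le> k")
    case False
    have "n - 1 choose k \<le> (n - 1) ^ k" using nk by (intro binomial_le_pow) auto
    then have "real (n - 1 choose k) \<le> real (n - 1) ^ k" by (metis of_nat_le_iff of_nat_power)
    also have "\<dots> \<le> (2 * real n) ^ k" by (intro power_mono) auto
    also have "\<dots> \<le> (2 * real n) ^ (6 * r + 8)"
      using False n1 by (intro power_increasing) (auto simp: s_def)
    finally show ?thesis using lt by blast
  next
    case True
    have "(2 * real n) ^ (s + r) \<le> (2 * real n) ^ (6 * r + 8)"
      using n1 by (intro power_increasing) (auto simp: s_def)
    from lt[OF this] have "?\<rho> \<le> 1 / (2 * real n) ^ (s + r)" using n1 by (simp add: field_simps)
    also have "\<dots> = (1 / (2 * real n)) ^ (s + r)" by (simp add: power_divide)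
    also have "\<dots> \<le> (k / (2 * real n)) ^ (s + r)"
      using k by (intro power_mono divide_right_mono) auto
    finally have 1: "?\<rho> \<le> (k / (2 * real n)) ^ (s + r)" .
    define g where "g = 1 + (real n - 2 * real k) / (2 * real k)"
    have g: "n / (4 * k) \<le> g" "2 \<le> g" using nk k by (auto simp: g_def field_simps)
    have "real (r * 2 ^ (r + 1)) < 2 ^ (2 * r + 1)" by (rule growth_target)
    \<comment> \<open>Of the \<open>s = 2 * r + 4\<close> factors \<open>g\<close>, one is bounded
      below by \<open>n / (4 * k)\<close> to cancel \<open>k / n\<close>, and the others by
      \<open>2\<close>.\<close>
    also have "\<dots> = 2 ^ (2 * r + 3) * (n / (4 * k)) * (real k / real n)"
      using k n1 by (simp add: field_simps power_add)
    also have "\<dots> \<le> g ^ (2 * r + 3) * g * (real k / real n)"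
      using g by (intro mult_right_mono mult_mono power_mono) auto
    also have "g ^ (2 * r + 3) * g = g ^ s" by (simp add: s_def eval_nat_numeral)
    finally show ?thesis using 1 True by (simp add: g_def)
  qed
qed

lemma one_plus_ge_exp_half:
  fixes x :: real
  assumes "0 \<le> x" "x \<le> 1"
  shows "exp (x / 2) \<le> 1 + x"
proof -
  have "exp (x / 2) \<le> 1 + x / 2 + (x / 2)\<^sup>2" using assms by (intro exp_bound) auto
  also have "(x / 2)\<^sup>2 \<le> x / 2"
    using assms mult_mono[of x 1 x x] by (simp add: power2_eq_square field_simps)
  finally show ?thesis by simp
qed

text \<open>Now \<open>k / n \<ge> 1/4\<close>, and the growth takes about \<open>k / t\<close>
  steps with \<open>t = n - 2 * k\<close>. For \<open>t\<close> at least of order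
  \<open>k powr (2/3)\<close> this is at most of order \<open>z = k powr (1/3)\<close>, while the
  exponent \<open>t\<^sup>2 / (16 * n)\<close> of the error is at least of that order; a large
  \<open>C\<close> lets the error win.\<close>

lemma parameters_dense:
  fixes n k r :: nat and C :: real
  assumes k: "1 \<le> k" and nk: "n \<le> 4 * k" and n: "2 * real k + C * real k powr (2/3) \<le> n"
    and C: "64 * (6400 * 2 ^ r + 12 + 3 * real r) \<le> C"
  shows "\<exists>s. error_bound r n k < 1 \<and> 2 * (s + r) \<le> k \<and> error_bound r n k \<le> (k / (2 * real n)) ^ (s + r) \<and>
      real (r * 2 ^ (r + 1)) < (1 + (real n - 2 * real k) / (2 * real k)) ^ s * (real k / real n)"
proof -
  define t where "t = real n - 2 * real k"
  define z where "z = real k powr (1/3)"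
  \<comment> \<open>Chosen so that \<open>exp (L / 2) = exp (2 * r + 3)\<close> is at least
    \<open>4 * 2 ^ (2 * r + 1)\<close>, the \<open>4\<close> making up for
    \<open>k / n \<ge> 1/4\<close>. The next choice of \<open>s\<close> guarantees
    \<open>s * t / (2 * k) \<ge> L\<close>.\<close>
  define L where "L = 4 * real r + 6"
  define s where "s = nat \<lceil>2 * real k * L / t\<rceil>"
  obtain y where y: "y = (2::real) ^ r" "0 < y" by simp
  have C4: "4 * L \<le> C" "2 * (4 + 2 * real r) \<le> C" "1 \<le> C" using C y(2) unfolding L_def y(1)[symmetric] by (simp_all add: distrib_left)
  have z1: "1 \<le> z" unfolding z_def using k by (intro ge_one_powr_ge_zero) auto
  have z3: "z ^ 3 = k" using k by (simp add: z_def powr_powr flip: powr_numeral)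
  have z2: "real k powr (2/3) = z\<^sup>2" by (simp add: z_def powr_powr flip: powr_numeral)
  have t: "C * z\<^sup>2 \<le> t" "t \<le> 2 * z ^ 3" using n nk unfolding z3 z2[symmetric] by (auto simp: t_def)
  have "C * z\<^sup>2 \<le> (2 * z) * z\<^sup>2" using t by (simp add: eval_nat_numeral)
  then have zC: "C \<le> 2 * z" using z1 by (simp add: mult_le_cancel_right)
  have Cz: "0 < C * z\<^sup>2" using C4 z1 by simp
  then have t0: "0 < t" using t by linarith
  have s_up: "s \<le> 2 * real k * L / t + 1" and s_lo: "2 * real k * L / t \<le> s"
  proof -
    have "0 \<le> 2 * real k * L / t" using t0 by (simp add: L_def)
    then show "s \<le> 2 * real k * L / t + 1" "2 * real k * L / t \<le> s" unfolding s_def by - linarith+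
  qed
  have "2 * real k * L / t \<le> 2 * z ^ 3 * L / (C * z\<^sup>2)"
    unfolding z3[symmetric] using t t0 Cz z1 by (intro divide_left_mono) (auto simp: L_def)
  also have "\<dots> = 2 * z * L / C" using z1 C4 by (simp add: eval_nat_numeral field_simps)
  also have "\<dots> \<le> z"
  proof -
    have "z * (4 * L) \<le> z * C" "0 \<le> z * L" using C4 z1 by (auto simp: L_def)
    then show ?thesis using C4 by (simp add: divide_le_eq mult_ac)
  qed
  finally have sr: "real (s + r) \<le> z + 1 + r" using s_up by simp
  have rz: "1 + real r \<le> (1 + r) * z" using z1 mult_left_mono[of 1 z "1 + real r"] by simp
  have "2 * real (s + r) \<le> (4 + 2 * r) * z" using sr rz by (simp add: algebra_simps)
  also have "\<dots> \<le> (z * z) * z"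
  proof (rule mult_right_mono)
    have "4 + 2 * real r \<le> z" using C4 zC by simp
    also have "z \<le> z * z" using z1 by simp
    finally show "real (4 + 2 * r) \<le> z * z" by simp
  qed (use z1 in simp)
  also have "\<dots> = k" unfolding z3[symmetric] by (simp add: eval_nat_numeral)
  finally have srk: "2 * (s + r) \<le> k" by linarith
  define A :: real where "A = 6400 * 2 ^ r"
  \<comment> \<open>The exponent budget: \<open>A\<close> pays for the constant
    \<open>6400 * 2 ^ r\<close>, a summand \<open>6\<close> for
    \<open>n ^ 2 \<le> 16 * exp (6 * z)\<close>, and the remaining \<open>6 + 3 * r\<close> for
    \<open>3 * (s + r) \<le> (6 + 3 * r) * z\<close>.\<close>
  define B where "B = A + 12 + 3 * r"
  have A0: "0 \<le> A" by (simp add: A_def)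
  have BC: "64 * B \<le> C" using C by (simp add: A_def B_def)
  have kn: "0 < k" "2 * real k \<le> n" using k t0 by (auto simp: t_def)
  have "B * z * (16 * real n) \<le> B * z * (64 * z ^ 3)"
    unfolding z3 using nk z1 A0 by (intro mult_left_mono) (auto simp: B_def)
  also have "\<dots> = (64 * B) * z ^ 4" by (simp add: eval_nat_numeral)
  also have "\<dots> \<le> C\<^sup>2 * z ^ 4"
  proof (rule mult_right_mono)
    have "C * 1 \<le> C * C" using C4 by (intro mult_left_mono) auto
    then show "64 * B \<le> C\<^sup>2" using BC by (simp add: power2_eq_square)
  qed simp
  also have "\<dots> = (C * z\<^sup>2)\<^sup>2" by (simp add: power_mult_distrib)
  also have "\<dots> \<le> t\<^sup>2" using t Cz by (intro power_mono) auto
  finally have "B * z \<le> t\<^sup>2 / (16 * real n)" using kn by (simp add: le_divide_eq)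
  then have e1: "exp (- (t\<^sup>2 / (16 * real n))) \<le> exp (- (B * z))" by simp
  have "real n \<le> 4 * z ^ 3" unfolding z3 using nk by simp
  then have "real n ^ 2 \<le> (4 * z ^ 3) ^ 2" by (intro power_mono) auto
  also have "\<dots> = 16 * z ^ 6" by (simp add: power_mult_distrib)
  also have "\<dots> \<le> 16 * exp (6 * z)"
  proof -
    have "z \<le> exp z" using exp_ge_add_one_self[of z] by linarith
    then have "z ^ 6 \<le> exp z ^ 6" using z1 by (intro power_mono) auto
    then show ?thesis by (simp add: exp_of_nat_mult[symmetric])
  qed
  finally have e2: "real n ^ 2 \<le> 16 * exp (6 * z)" .
  have e3: "A \<le> exp (A * z)"
  proof -
    have "A * 1 \<le> A * z" using A0 z1 by (intro mult_left_mono) auto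
    then show ?thesis using exp_ge_add_one_self[of "A * z"] by linarith
  qed
  have "error_bound r n k = 400 * 2 ^ r * (real n ^ 2 * exp (- (t\<^sup>2 / (16 * real n))))"
    by (simp add: error_bound_def t_def)
  also have "\<dots> \<le> 400 * 2 ^ r * (16 * exp (6 * z) * exp (- (B * z)))"
    using e1 e2 by (intro mult_left_mono mult_mono) auto
  also have "\<dots> = A * (exp (6 * z) * exp (- (B * z)))" by (simp add: A_def)
  also have "\<dots> \<le> exp (A * z) * (exp (6 * z) * exp (- (B * z)))"
    using e3 by (intro mult_right_mono) auto
  also have "\<dots> = exp (- ((6 + 3 * real r) * z))"
    by (simp add: exp_add[symmetric] B_def algebra_simps)
  finally have err: "error_bound r n k \<le> exp (- ((6 + 3 * real r) * z))" .
  have "exp (- ((6 + 3 * real r) * z)) < 1" using z1 by simp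
  with err have err1: "error_bound r n k < 1" by (rule le_less_trans)
  note err
  also have "exp (- ((6 + 3 * real r) * z)) \<le> exp (- (3 * real (s + r)))"
    using sr rz by (simp add: algebra_simps)
  also have "\<dots> = exp (-3) ^ (s + r)" by (simp add: exp_of_nat_mult[symmetric] mult.commute)
  also have "\<dots> \<le> (k / (2 * real n)) ^ (s + r)"
  proof (rule power_mono)
    have "(2::real) ^ 3 \<le> exp 1 ^ 3" using exp_ge_add_one_self[of 1] by (intro power_mono) auto
    then have "8 \<le> exp (3::real)" by (simp add: exp_of_nat_mult[symmetric])
    then have "exp (-3::real) \<le> 1 / 8" by (simp add: exp_minus field_simps)
    also have "1 / 8 \<le> k / (2 * real n)" using nk kn by (simp add: field_simps)
    finally show "exp (-3) \<le> k / (2 * real n)" .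
  qed simp
  finally have err2: "error_bound r n k \<le> (k / (2 * real n)) ^ (s + r)" .
  define x where "x = t / (2 * real k)"
  have x: "0 \<le> x" "x \<le> 1" using t0 t kn unfolding z3 x_def by auto
  have "real (r * 2 ^ (r + 1)) < 2 ^ (2 * r + 1)" by (rule growth_target)
  also have "\<dots> = 2 ^ (2 * r + 3) * (1 / 4)" by (simp add: power_add)
  also have "\<dots> \<le> (1 + x) ^ s * (real k / real n)"
  proof (rule mult_mono)
    have "(2::real) ^ (2 * r + 3) \<le> exp 1 ^ (2 * r + 3)"
      using exp_ge_add_one_self[of 1] by (intro power_mono) auto
    also have "\<dots> = exp (L / 2)" by (simp add: exp_of_nat_mult[symmetric] L_def)
    also have "\<dots> \<le> exp (s * (x / 2))"
    proof -
      have "L = 2 * real k * L / t * x" using t0 kn by (simp add: x_def)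
      also have "\<dots> \<le> s * x" using s_lo x by (intro mult_right_mono) auto
      finally show ?thesis by simp
    qed
    also have "\<dots> = exp (x / 2) ^ s" by (rule exp_of_nat_mult)
    also have "\<dots> \<le> (1 + x) ^ s" using one_plus_ge_exp_half[OF x] by (intro power_mono) auto
    finally show "2 ^ (2 * r + 3) \<le> (1 + x) ^ s" .
    show "1 / 4 \<le> k / real n" using nk kn by (simp add: field_simps)
  qed (use x in auto)
  finally have "real (r * 2 ^ (r + 1)) < (1 + (real n - 2 * real k) / (2 * real k)) ^ s * (real k / real n)"
    by (simp add: x_def t_def)
  then show ?thesis using err1 err2 srk by blast
qed

section \<open>The constant and the reduction to exactly \<open>r\<close> families\<close>

theorem theorem1p3:
  fixes r :: nat
  assumes "r \<ge> 2"
  shows "\<exists>C::real. C > 0 \<and>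
    (\<forall>(n::nat) (k::nat) (F::nat set set).
       n > 0 \<longrightarrow> k > 0 \<longrightarrow>
       real n \<ge> 2 * real k + C * real k powr (2/3) \<longrightarrow>
       F \<subseteq> [{1..n}]\<^bsup>k\<^esup> \<longrightarrow>
       union_of_intersecting r n k F \<longrightarrow>
         card F \<le> (n choose k) - ((n - r) choose k) \<and>
         (card F = (n choose k) - ((n - r) choose k) \<longrightarrow>
            (\<exists>R\<in>[{1..n}]\<^bsup>r\<^esup>. F = {S\<in>[{1..n}]\<^bsup>k\<^esup>. S \<inter> R \<noteq> {}})))"
proof -
  have r: "1 \<le> r" using assms by simp
  obtain n0 where n0: "\<And>n. n0 \<le> n \<Longrightarrow>
      400 * 2 ^ r * real n ^ 2 * (2 * real n) ^ (6 * r + 8) * exp (- (real n / 64)) < 1"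
    using polynomial_error_eventually_small[of "400 * 2 ^ r" "6 * r + 8"] by blast
  obtain y where y: "y = (2::real) ^ r" "0 < y" by simp
  \<comment> \<open>The summand \<open>n0\<close> makes every admissible \<open>n\<close> at least
    \<open>n0\<close>, since \<open>k powr (2/3) \<ge> 1\<close>; the rest is what
    \<open>parameters_dense\<close> asks for.\<close>
  define C :: real where "C = real n0 + 64 * (6400 * 2 ^ r + 12 + 3 * real r)"
  have C: "0 < C" "real n0 \<le> C" "2 * real r \<le> C"
    using y(2) unfolding C_def y(1)[symmetric] by (simp_all add: distrib_left)
  \<comment> \<open>A union at least as large as the bound is a star. This settles equality, and it
    excludes larger unions because the star has exactly the size of the bound.\<close>
  have main: "\<exists>R\<in>[{1..n}]\<^bsup>r\<^esup>. F = {S\<in>[{1..n}]\<^bsup>k\<^esup>. S \<inter> R \<noteq> {}}"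
    if k: "k > 0" and n: "2 * real k + C * real k powr (2/3) \<le> real n"
      and U: "union_of_intersecting r n k F"
      and large: "(n choose k) - ((n - r) choose k) \<le> card F" for n k F
  proof -
    have k1: "1 \<le> k" using k by simp
    have "1 \<le> real k powr (2/3)" using k by (intro ge_one_powr_ge_zero) auto
    then have "C * 1 \<le> C * real k powr (2/3)" using C(1) by (intro mult_left_mono) auto
    then have nC: "2 * real k + C \<le> n" using n by simp
    have nr: "2 * k + 2 * r \<le> n" and nn0: "n0 \<le> n" using nC C by - linarith+
    obtain m G where G: "m \<le> r" "\<And>i. i \<in> {1..m} \<Longrightarrow> G i \<subseteq> [{1..n}]\<^bsup>k\<^esup>"
      "\<And>i. i \<in> {1..m} \<Longrightarrow> intersecting (G i)" "F = (\<Union>i\<in>{1..m}. G i)"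
      using U unfolding union_of_intersecting_def by blast
    \<comment> \<open>The empty family is intersecting, so the \<open>m\<close> families can be
      padded to exactly \<open>r\<close>.\<close>
    define H where "H = (\<lambda>i. if i \<in> {1..m} then G i else {})"
    have FH: "F = (\<Union>i\<in>{1..r}. H i)" 
    proof -
      have "(\<Union>i\<in>{1..r}. H i) = (\<Union>i\<in>{1..r} \<inter> {1..m}. G i)"
        unfolding H_def by (auto split: if_splits)
      moreover have "{1..r} \<inter> {1..m} = {1..m}" using G(1) by auto
      ultimately show ?thesis using G(4) by (simp only:)
    qed
    have H: "H i \<subseteq> [{1..n}]\<^bsup>k\<^esup>" "intersecting (H i)" for i
    proof -
      have e: "intersecting ({} :: nat set set)" by (simp add: intersecting_def)
      show "H i \<subseteq> [{1..n}]\<^bsup>k\<^esup>" using G(2)[of i] unfolding H_def by simp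
      show "intersecting (H i)" using G(3)[of i] e unfolding H_def by simp
    qed
    have "\<exists>s. error_bound r n k < 1 \<and> (error_bound r n k * (n - 1 choose k) < 1 \<or>
      2 * (s + r) \<le> k \<and> error_bound r n k \<le> (k / (2 * real n)) ^ (s + r) \<and>
      real (r * 2 ^ (r + 1)) < (1 + (real n - 2 * real k) / (2 * real k)) ^ s * (real k / real n))"
    proof (cases "4 * k < n")
      case True
      show ?thesis
        by (intro exI[of _ "2 * r + 4"] conjI parameters_sparse[OF True k1 n0[OF nn0]])
    next
      case False
      then have "n \<le> 4 * k" by simp
      from parameters_dense[OF k1 this n, of r] show ?thesis unfolding C_def by auto
    qed
    then obtain s where s: "error_bound r n k < 1"
      "error_bound r n k * (n - 1 choose k) < 1 \<or>
      2 * (s + r) \<le> k \<and> error_bound r n k \<le> (k / (2 * real n)) ^ (s + r) \<and>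
      real (r * 2 ^ (r + 1)) < (1 + (real n - 2 * real k) / (2 * real k)) ^ s * (real k / real n)"
      by blast
    show ?thesis
      unfolding FH
      by (rule extremal_imp_star[OF _ _ k1 nr r _ _ H large[unfolded FH] s]) auto
  qed
  have "card F \<le> (n choose k) - ((n - r) choose k) \<and>
         (card F = (n choose k) - ((n - r) choose k) \<longrightarrow>
            (\<exists>R\<in>[{1..n}]\<^bsup>r\<^esup>. F = {S\<in>[{1..n}]\<^bsup>k\<^esup>. S \<inter> R \<noteq> {}}))"
    if h: "k > 0" "2 * real k + C * real k powr (2/3) \<le> real n" "union_of_intersecting r n k F" for n k F
  proof (intro conjI impI)
    show "card F \<le> (n choose k) - ((n - r) choose k)"
    proof (rule ccontr)
      assume c: "\<not> ?thesis"
      then obtain R where R: "R \<in> [{1..n}]\<^bsup>r\<^esup>" "F = {S\<in>[{1..n}]\<^bsup>k\<^esup>. S \<inter> R \<noteq> {}}"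
        using main[OF h] by auto
      have "card F = (n choose k) - ((n - r) choose k)"
        unfolding R(2) using R(1) by (subst card_star) (auto simp: nsets_def)
      then show False using c by simp
    qed
  next
    assume "card F = (n choose k) - ((n - r) choose k)"
    then show "\<exists>R\<in>[{1..n}]\<^bsup>r\<^esup>. F = {S\<in>[{1..n}]\<^bsup>k\<^esup>. S \<inter> R \<noteq> {}}"
      using main[OF h] by simp
  qed
  with C(1) show ?thesis by blast
qed

end
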